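(* Let $T:\Delta\to\Delta$ be an endofunctor of the simplex category, represented as a finite sum $T=B_0+B_1+\cdots+B_n$ of basis functors $B_i\in\{Id,C_0,Op\}$. The induced functor $T^*:SSet\to SSet$ preserves weak equivalences if and only if the constant $0$ functor $C_0$ does not appear in this representation, i.e. $B_i\neq C_0$ for all $i$.
   Context: The simplex category $\Delta$ has as objects the totally ordered nonempty finite sets and as morphisms the order preserving (i.e. weakly monotone) maps. Since every object is uniquely isomorphic to exactly one $[n]=\{0,1,\dots,n\}$, $n\ge 0$, the objects are taken to be the sets $[n]$. $SSet$ is the category of simplicial sets, i.e. functors $\Delta^{op}\to Set$; weak equivalences are the usual weak homotopy equivalences of simplicial sets. An endofunctor $T:\Delta\to\Delta$ induces $T^*:SSet\to SSet$ by precomposition, $T^*(X)=X\circ T$ (more precisely $X\circ T^{op}$). Basis endofunctors $\Delta\to\Delta$: $Id$ is the identity functor; $C_0$ is the constant functor sending every object to $[0]$ and every morphism to $\mathrm{id}_{[0]}$; $Op$ is the identity on objects and sends $f:[n]\to[m]$ to $Op(f):[n]\to[m]$, $Op(f)(k)=m-f(n-k)$. The concatenation bifunctor $*:\Delta\times\Delta\to\Delta$ is given on objects by $[n]*[m]=[n+m+1]$, and for $f:[n_1]\to[n_2]$, $g:[m_1]\to[m_2]$ the map $f*g:[n_1+m_1+1]\to[n_2+m_2+1]$ is $(f*g)(k)=f(k)$ for $0\le k\le n_1$ and $(f*g)(k)=n_2+1+g(k-n_1-1)$ for $n_1<k\le n_1+m_1+1$. For endofunctors $T_1,T_2$ of $\Delta$,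 the sum $T_1+T_2$ is the composite $\Delta\xrightarrow{(T_1,T_2)}\Delta\times\Delta\xrightarrow{*}\Delta$. This operation is associative. Every endofunctor of $\Delta$ is a finite sum of basis functors. *)

theory Defs
  imports "HOL-Homology.Homology"
begin

section \<open>The simplex category\<close>

text \<open>A morphism \<open>[m] \<rightarrow> [n]\<close> is a weakly monotone function on \<open>{..m}\<close>, extended by
  \<open>undefined\<close> elsewhere, so that equality of morphisms is equality in HOL.\<close>

definition simplex_hom :: "nat \<Rightarrow> nat \<Rightarrow> (nat \<Rightarrow> nat) set" where
  "simplex_hom m n = {f \<in> {..m} \<rightarrow>\<^sub>E {..n}. mono_on {..m} f}"

definition simplex_id :: "nat \<Rightarrow> nat \<Rightarrow> nat" where
  "simplex_id n = restrict id {..n}"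

text \<open>The first argument of \<open>simplex_comp\<close> is the source of the right factor \<open>f\<close>.\<close>

definition simplex_comp :: "nat \<Rightarrow> (nat \<Rightarrow> nat) \<Rightarrow> (nat \<Rightarrow> nat) \<Rightarrow> nat \<Rightarrow> nat" where
  "simplex_comp m g f = compose {..m} g f"

section \<open>Endofunctors of the simplex category\<close>

text \<open>\<open>mor T m n f\<close> is the value of \<open>T\<close> on \<open>f : [m] \<rightarrow> [n]\<close>. It is \<open>undefined\<close> when \<open>f\<close> is not
  such a morphism, so equality of functors is equality of records.\<close>

record simplex_functor =
  obj :: "nat \<Rightarrow> nat"
  mor :: "nat \<Rightarrow> nat \<Rightarrow> (nat \<Rightarrow> nat) \<Rightarrow> (nat \<Rightarrow> nat)"

definition is_endofunctor :: "simplex_functor \<Rightarrow> bool" where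
  "is_endofunctor T \<longleftrightarrow>
     (\<forall>m n. \<forall>f \<in> simplex_hom m n. mor T m n f \<in> simplex_hom (obj T m) (obj T n)) \<and>
     (\<forall>m n f. f \<notin> simplex_hom m n \<longrightarrow> mor T m n f = undefined) \<and>
     (\<forall>n. mor T n n (simplex_id n) = simplex_id (obj T n)) \<and>
     (\<forall>l m n. \<forall>f \<in> simplex_hom l m. \<forall>g \<in> simplex_hom m n.
        mor T l n (simplex_comp l g f) = simplex_comp (obj T l) (mor T m n g) (mor T l m f))"

definition Id_functor :: simplex_functor where
  "Id_functor = \<lparr>obj = (\<lambda>n. n),
     mor = (\<lambda>m n f. if f \<in> simplex_hom m n then f else undefined)\<rparr>"

definition C0_functor :: simplex_functor where
  "C0_functor = \<lparr>obj = (\<lambda>n. 0),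
     mor = (\<lambda>m n f. if f \<in> simplex_hom m n then simplex_id 0 else undefined)\<rparr>"

definition Op_functor :: simplex_functor where
  "Op_functor = \<lparr>obj = (\<lambda>n. n),
     mor = (\<lambda>m n f. if f \<in> simplex_hom m n then (\<lambda>k\<in>{..m}. n - f (m - k)) else undefined)\<rparr>"

text \<open>\<open>concat_map n1 m1 n2 f g\<close> is \<open>f * g : [n1 + m1 + 1] \<rightarrow> [n2 + m2 + 1]\<close> for
  \<open>f : [n1] \<rightarrow> [n2]\<close> and \<open>g : [m1] \<rightarrow> [m2]\<close>.\<close>

definition concat_map :: "nat \<Rightarrow> nat \<Rightarrow> nat \<Rightarrow> (nat \<Rightarrow> nat) \<Rightarrow> (nat \<Rightarrow> nat) \<Rightarrow> nat \<Rightarrow> nat" where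
  "concat_map n1 m1 n2 f g =
     (\<lambda>k\<in>{..n1 + m1 + 1}. if k \<le> n1 then f k else n2 + 1 + g (k - n1 - 1))"

definition functor_add :: "simplex_functor \<Rightarrow> simplex_functor \<Rightarrow> simplex_functor" where
  "functor_add S T = \<lparr>obj = (\<lambda>n. obj S n + obj T n + 1),
     mor = (\<lambda>m n f. if f \<in> simplex_hom m n
              then concat_map (obj S m) (obj T m) (obj S n) (mor S m n f) (mor T m n f)
              else undefined)\<rparr>"

text \<open>\<open>functor_sum B n\<close> is \<open>B 0 + B 1 + \<cdots> + B n\<close>.\<close>

primrec functor_sum :: "(nat \<Rightarrow> simplex_functor) \<Rightarrow> nat \<Rightarrow> simplex_functor" where
  "functor_sum B 0 = B 0"
| "functor_sum B (Suc n) = functor_add (functor_sum B n) (B (Suc n))"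

section \<open>Simplicial sets\<close>

text \<open>\<open>act X m n f : simplices X n \<rightarrow> simplices X m\<close> is the action of \<open>f : [m] \<rightarrow> [n]\<close>. Only its
  values for \<open>f \<in> simplex_hom m n\<close> on \<open>simplices X n\<close> matter, and likewise for simplicial maps.\<close>

record 'a sset =
  simplices :: "nat \<Rightarrow> 'a set"
  act :: "nat \<Rightarrow> nat \<Rightarrow> (nat \<Rightarrow> nat) \<Rightarrow> 'a \<Rightarrow> 'a"

definition simplicial_set :: "'a sset \<Rightarrow> bool" where
  "simplicial_set X \<longleftrightarrow>
     (\<forall>m n. \<forall>f \<in> simplex_hom m n. act X m n f \<in> simplices X n \<rightarrow> simplices X m) \<and>
     (\<forall>n. \<forall>x \<in> simplices X n. act X n n (simplex_id n) x = x) \<and>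
     (\<forall>l m n. \<forall>f \<in> simplex_hom l m. \<forall>g \<in> simplex_hom m n. \<forall>x \<in> simplices X n.
        act X l n (simplex_comp l g f) x = act X l m f (act X m n g x))"

definition sset_map :: "'a sset \<Rightarrow> 'b sset \<Rightarrow> (nat \<Rightarrow> 'a \<Rightarrow> 'b) \<Rightarrow> bool" where
  "sset_map X Y \<phi> \<longleftrightarrow>
     (\<forall>n. \<phi> n \<in> simplices X n \<rightarrow> simplices Y n) \<and>
     (\<forall>m n. \<forall>f \<in> simplex_hom m n. \<forall>x \<in> simplices X n.
        \<phi> m (act X m n f x) = act Y m n f (\<phi> n x))"

definition pullback_sset :: "simplex_functor \<Rightarrow> 'a sset \<Rightarrow> 'a sset" where
  "pullback_sset T X = \<lparr>simplices = (\<lambda>n. simplices X (obj T n)),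
     act = (\<lambda>m n f. act X (obj T m) (obj T n) (mor T m n f))\<rparr>"

definition pullback_sset_map :: "simplex_functor \<Rightarrow> (nat \<Rightarrow> 'a \<Rightarrow> 'b) \<Rightarrow> nat \<Rightarrow> 'a \<Rightarrow> 'b" where
  "pullback_sset_map T \<phi> = (\<lambda>n. \<phi> (obj T n))"

section \<open>Geometric realization\<close>

text \<open>The affine map of standard simplices induced by \<open>f : [m] \<rightarrow> [n]\<close> on vertices.\<close>

definition simplex_push :: "nat \<Rightarrow> (nat \<Rightarrow> nat) \<Rightarrow> (nat \<Rightarrow> real) \<Rightarrow> nat \<Rightarrow> real" where
  "simplex_push m f t = (\<lambda>i. \<Sum>j | j \<le> m \<and> f j = i. t j)"

text \<open>The disjoint union of one copy of the standard \<open>n\<close>-simplex for each pair \<open>(n, x)\<close>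
  with \<open>x \<in> simplices X n\<close>.\<close>

definition presentation_space :: "'a sset \<Rightarrow> ((nat \<times> 'a) \<times> (nat \<Rightarrow> real)) topology" where
  "presentation_space X =
     sum_topology (\<lambda>(n, x). subtopology (powertop_real UNIV) (standard_simplex n))
       (SIGMA n:UNIV. simplices X n)"

inductive glue :: "'a sset \<Rightarrow> (nat \<times> 'a) \<times> (nat \<Rightarrow> real) \<Rightarrow> (nat \<times> 'a) \<times> (nat \<Rightarrow> real) \<Rightarrow> bool"
  for X where
  "f \<in> simplex_hom m n \<Longrightarrow> x \<in> simplices X n \<Longrightarrow> t \<in> standard_simplex m \<Longrightarrow>
     glue X ((m, act X m n f x), t) ((n, x), simplex_push m f t)"

definition glue_class ::
    "'a sset \<Rightarrow> (nat \<times> 'a) \<times> (nat \<Rightarrow> real) \<Rightarrow> ((nat \<times> 'a) \<times> (nat \<Rightarrow> real)) set" where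
  "glue_class X p = {q. equivclp (glue X) p q}"

text \<open>The quotient topology on the set of equivalence classes.\<close>

definition realization :: "'a sset \<Rightarrow> ((nat \<times> 'a) \<times> (nat \<Rightarrow> real)) set topology" where
  "realization X = topology (\<lambda>U.
     U \<subseteq> glue_class X ` topspace (presentation_space X) \<and>
     openin (presentation_space X) {p \<in> topspace (presentation_space X). glue_class X p \<in> U})"

text \<open>The classes in the union below all coincide when \<open>\<phi>\<close> is a simplicial map and \<open>c\<close> a point of
  the realization (lemma \<open>realization_map_class\<close>); the union just selects their common value.\<close>

definition realization_map ::
    "'b sset \<Rightarrow> (nat \<Rightarrow> 'a \<Rightarrow> 'b) \<Rightarrow> ((nat \<times> 'a) \<times> (nat \<Rightarrow> real)) set
      \<Rightarrow> ((nat \<times> 'b) \<times> (nat \<Rightarrow> real)) set" where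
  "realization_map Y \<phi> c = (\<Union>((n, x), t) \<in> c. glue_class Y ((n, \<phi> n x), t))"

section \<open>Weak homotopy equivalences\<close>

definition sphere_base :: "nat \<Rightarrow> real" where
  "sphere_base = (\<lambda>i. if i = 0 then 1 else 0)"

definition pointed_homotopy_class ::
    "nat \<Rightarrow> 'a topology \<Rightarrow> 'a \<Rightarrow> ((nat \<Rightarrow> real) \<Rightarrow> 'a) \<Rightarrow> ((nat \<Rightarrow> real) \<Rightarrow> 'a) set" where
  "pointed_homotopy_class n X x p =
     {q. homotopic_with (\<lambda>h. h sphere_base = x) (nsphere n) X p q}"

text \<open>The underlying set of \<open>\<pi>\<^sub>n(X, x)\<close>: pointed homotopy classes of pointed maps from the
  \<open>n\<close>-sphere.\<close>

definition homotopy_group_set ::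
    "nat \<Rightarrow> 'a topology \<Rightarrow> 'a \<Rightarrow> ((nat \<Rightarrow> real) \<Rightarrow> 'a) set set" where
  "homotopy_group_set n X x =
     pointed_homotopy_class n X x ` {p. continuous_map (nsphere n) X p \<and> p sphere_base = x}"

text \<open>As for \<open>realization_map\<close>, the two unions below select the common value of a function that
  is constant on the class (respectively path component) \<open>c\<close>.\<close>

definition homotopy_group_map ::
    "nat \<Rightarrow> 'b topology \<Rightarrow> 'a \<Rightarrow> ('a \<Rightarrow> 'b) \<Rightarrow> ((nat \<Rightarrow> real) \<Rightarrow> 'a) set
      \<Rightarrow> ((nat \<Rightarrow> real) \<Rightarrow> 'b) set" where
  "homotopy_group_map n Y x f c = (\<Union>p\<in>c. pointed_homotopy_class n Y (f x) (f \<circ> p))"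

definition path_components_map :: "'b topology \<Rightarrow> ('a \<Rightarrow> 'b) \<Rightarrow> 'a set \<Rightarrow> 'b set" where
  "path_components_map Y f c = (\<Union>x\<in>c. path_component_of_set Y (f x))"

text \<open>The map induced on homotopy groups is always a group homomorphism, so it is an isomorphism
  exactly when it is bijective; the group operation therefore does not appear here.\<close>

definition weak_homotopy_equivalence :: "'a topology \<Rightarrow> 'b topology \<Rightarrow> ('a \<Rightarrow> 'b) \<Rightarrow> bool" where
  "weak_homotopy_equivalence X Y f \<longleftrightarrow>
     continuous_map X Y f \<and>
     bij_betw (path_components_map Y f) (path_components_of X) (path_components_of Y) \<and>
     (\<forall>n\<ge>1. \<forall>x \<in> topspace X.
        bij_betw (homotopy_group_map n Y x f)
          (homotopy_group_set n X x) (homotopy_group_set n Y (f x)))"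

definition sset_weak_equivalence :: "'a sset \<Rightarrow> 'b sset \<Rightarrow> (nat \<Rightarrow> 'a \<Rightarrow> 'b) \<Rightarrow> bool" where
  "sset_weak_equivalence X Y \<phi> \<longleftrightarrow>
     sset_map X Y \<phi> \<and>
     weak_homotopy_equivalence (realization X) (realization Y) (realization_map Y \<phi>)"

section \<open>Basic properties\<close>

lemma simplex_id_in_hom: "simplex_id n \<in> simplex_hom n n"
  by (auto simp: simplex_id_def simplex_hom_def mono_on_def)

lemma simplex_comp_in_hom:
  assumes "f \<in> simplex_hom l m" "g \<in> simplex_hom m n"
  shows "simplex_comp l g f \<in> simplex_hom l n"
  using assms unfolding simplex_comp_def simplex_hom_def
  by (auto simp: mono_on_def compose_def Pi_iff PiE_iff)

lemma simplex_homD: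
  assumes "f \<in> simplex_hom m n"
  shows "k \<le> m \<Longrightarrow> f k \<le> n" "j \<le> k \<Longrightarrow> k \<le> m \<Longrightarrow> f j \<le> f k"
  using assms by (auto simp: simplex_hom_def mono_on_def)

lemma is_endofunctor_Id: "is_endofunctor Id_functor"
  by (auto simp: is_endofunctor_def Id_functor_def simplex_id_in_hom simplex_comp_in_hom)

lemma is_endofunctor_C0: "is_endofunctor C0_functor"
  by (auto simp: is_endofunctor_def C0_functor_def simplex_id_in_hom simplex_comp_in_hom)
    (auto simp: simplex_id_def simplex_comp_def compose_def)

lemma is_endofunctor_Op: "is_endofunctor Op_functor"
proof -
  have "(\<lambda>k\<in>{..m}. n - f (m - k)) \<in> simplex_hom m n" if f: "f \<in> simplex_hom m n" for m n f
    using simplex_homD[OF f]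
    by (auto simp: simplex_hom_def mono_on_def intro!: diff_le_mono2)
  moreover have "(\<lambda>k\<in>{..n}. n - simplex_id n (n - k)) = simplex_id n" for n
    by (auto simp: simplex_id_def)
  moreover have "(\<lambda>k\<in>{..l}. n - simplex_comp l g f (l - k)) =
      simplex_comp l (\<lambda>k\<in>{..m}. n - g (m - k)) (\<lambda>k\<in>{..l}. m - f (l - k))"
    if f: "f \<in> simplex_hom l m" for l m n f g
    using simplex_homD(1)[OF f] by (auto simp: simplex_comp_def compose_def fun_eq_iff)
  ultimately show ?thesis
    unfolding is_endofunctor_def Op_functor_def
    by (simp add: simplex_id_in_hom simplex_comp_in_hom)
qed

lemma is_endofunctor_add:
  assumes S: "is_endofunctor S" and T: "is_endofunctor T"
  shows "is_endofunctor (functor_add S T)"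
proof -
  have hom: "concat_map n1 m1 n2 f g \<in> simplex_hom (n1 + m1 + 1) (n2 + m2 + 1)"
    if f: "f \<in> simplex_hom n1 n2" and g: "g \<in> simplex_hom m1 m2" for n1 m1 n2 m2 f g
  proof -
    have "concat_map n1 m1 n2 f g k \<le> n2 + m2 + 1" if "k \<le> n1 + m1 + 1" for k
      using simplex_homD(1)[OF f, of k] simplex_homD(1)[OF g, of "k - n1 - 1"] that
      by (auto simp: concat_map_def)
    moreover have "concat_map n1 m1 n2 f g j \<le> concat_map n1 m1 n2 f g k"
      if "j \<le> k" "k \<le> n1 + m1 + 1" for j k
      using simplex_homD(1)[OF f, of j] simplex_homD(2)[OF f, of j k]
        simplex_homD(2)[OF g, of "j - n1 - 1" "k - n1 - 1"] that
      by (auto simp: concat_map_def)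
    ultimately show ?thesis
      by (auto simp: simplex_hom_def mono_on_def PiE_iff concat_map_def)
  qed
  have ident: "concat_map a b a (simplex_id a) (simplex_id b) = simplex_id (a + b + 1)" for a b
    by (auto simp: concat_map_def simplex_id_def fun_eq_iff)
  have comp: "concat_map a1 b1 a3 (simplex_comp a1 g f) (simplex_comp b1 g' f') =
      simplex_comp (a1 + b1 + 1) (concat_map a2 b2 a3 g g') (concat_map a1 b1 a2 f f')"
    if f: "f \<in> simplex_hom a1 a2" and f': "f' \<in> simplex_hom b1 b2"
    for a1 b1 a2 b2 a3 g f g' f'
  proof
    fix k
    show "concat_map a1 b1 a3 (simplex_comp a1 g f) (simplex_comp b1 g' f') k =
      simplex_comp (a1 + b1 + 1) (concat_map a2 b2 a3 g g') (concat_map a1 b1 a2 f f') k"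
      using simplex_homD(1)[OF f, of k] simplex_homD(1)[OF f', of "k - a1 - 1"]
      by (auto simp: concat_map_def simplex_comp_def compose_def)
  qed
  have hS: "mor S m n f \<in> simplex_hom (obj S m) (obj S n)"
   and hT: "mor T m n f \<in> simplex_hom (obj T m) (obj T n)" if "f \<in> simplex_hom m n" for m n f
    using S T that by (auto simp: is_endofunctor_def)
  show ?thesis
    unfolding is_endofunctor_def
  proof (intro conjI allI ballI impI)
    fix l m n f g
    assume f: "f \<in> simplex_hom l m" and g: "g \<in> simplex_hom m n"
    have "mor S l n (simplex_comp l g f) = simplex_comp (obj S l) (mor S m n g) (mor S l m f)"
      "mor T l n (simplex_comp l g f) = simplex_comp (obj T l) (mor T m n g) (mor T l m f)"
      using S T f g by (auto simp: is_endofunctor_def)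
    then show "mor (functor_add S T) l n (simplex_comp l g f) =
       simplex_comp (obj (functor_add S T) l)
         (mor (functor_add S T) m n g) (mor (functor_add S T) l m f)"
      using f g comp[OF hS[OF f] hT[OF f]]
      by (simp add: functor_add_def simplex_comp_in_hom[OF f g])
  next
    fix n
    show "mor (functor_add S T) n n (simplex_id n) = simplex_id (obj (functor_add S T) n)"
      using S T ident[of "obj S n" "obj T n"]
      by (simp add: functor_add_def simplex_id_in_hom is_endofunctor_def)
  next
    fix m n f assume "f \<in> simplex_hom m n"
    then show "mor (functor_add S T) m n f
        \<in> simplex_hom (obj (functor_add S T) m) (obj (functor_add S T) n)"
      using hom[OF hS hT] by (simp add: functor_add_def)
  qed (simp add: functor_add_def)
qed

lemma is_endofunctor_sum:
  "(\<And>i. i \<le> n \<Longrightarrow> is_endofunctor (B i)) \<Longrightarrow> is_endofunctor (functor_sum B n)"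
  by (induction n) (auto intro: is_endofunctor_add)

lemma simplicial_set_pullback:
  "is_endofunctor T \<Longrightarrow> simplicial_set X \<Longrightarrow> simplicial_set (pullback_sset T X)"
  by (simp add: is_endofunctor_def simplicial_set_def pullback_sset_def)

lemma sset_map_pullback:
  "is_endofunctor T \<Longrightarrow> sset_map X Y \<phi> \<Longrightarrow>
    sset_map (pullback_sset T X) (pullback_sset T Y) (pullback_sset_map T \<phi>)"
  by (simp add: is_endofunctor_def sset_map_def pullback_sset_def pullback_sset_map_def)

lemma openin_realization:
  "openin (realization X) U \<longleftrightarrow>
     U \<subseteq> glue_class X ` topspace (presentation_space X) \<and>
     openin (presentation_space X) {p \<in> topspace (presentation_space X). glue_class X p \<in> U}"
proof -
  let ?D = "presentation_space X"
  let ?O = "\<lambda>U. U \<subseteq> glue_class X ` topspace ?D \<and> openin ?D {p \<in> topspace ?D. glue_class X p \<in> U}"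
  have "istopology ?O"
    unfolding istopology_def
  proof (intro conjI allI impI)
    fix S T assume *: "?O S" "?O T"
    have "{p \<in> topspace ?D. glue_class X p \<in> S \<inter> T} =
      {p \<in> topspace ?D. glue_class X p \<in> S} \<inter> {p \<in> topspace ?D. glue_class X p \<in> T}" by auto
    then show "openin ?D {p \<in> topspace ?D. glue_class X p \<in> S \<inter> T}" using * by auto
    show "S \<inter> T \<subseteq> glue_class X ` topspace ?D" using * by auto
  next
    fix K assume *: "\<forall>U\<in>K. ?O U"
    have "{p \<in> topspace ?D. glue_class X p \<in> \<Union>K} =
      (\<Union>U\<in>K. {p \<in> topspace ?D. glue_class X p \<in> U})" by auto
    then show "openin ?D {p \<in> topspace ?D. glue_class X p \<in> \<Union>K}" using * by auto
    show "\<Union>K \<subseteq> glue_class X ` topspace ?D" using * by auto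
  qed
  then show ?thesis by (simp add: realization_def topology_inverse')
qed

lemma topspace_realization:
  "topspace (realization X) = glue_class X ` topspace (presentation_space X)"
proof
  show "topspace (realization X) \<subseteq> glue_class X ` topspace (presentation_space X)"
    using openin_realization[of X "topspace (realization X)"] by simp
  have "{p \<in> topspace (presentation_space X).
      glue_class X p \<in> glue_class X ` topspace (presentation_space X)} =
    topspace (presentation_space X)" by blast
  then have "openin (realization X) (glue_class X ` topspace (presentation_space X))"
    by (simp only: openin_realization openin_topspace order_refl simp_thms)
  then show "glue_class X ` topspace (presentation_space X) \<subseteq> topspace (realization X)"
    by (rule openin_subset)
qed

lemma quotient_map_realization:
  "quotient_map (presentation_space X) (realization X) (glue_class X)"
  by (auto simp: quotient_map_def topspace_realization openin_realization)

lemma topspace_presentation_space: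
  "topspace (presentation_space X) = {((n, x), t). x \<in> simplices X n \<and> t \<in> standard_simplex n}"
  by (auto simp: presentation_space_def)

lemma glue_class_eq_iff: "glue_class X p = glue_class X q \<longleftrightarrow> equivclp (glue X) p q"
proof
  assume "glue_class X p = glue_class X q"
  then have "q \<in> glue_class X p" by (simp add: glue_class_def)
  then show "equivclp (glue X) p q" by (simp add: glue_class_def)
next
  assume "equivclp (glue X) p q"
  then show "glue_class X p = glue_class X q"
    unfolding glue_class_def by (blast intro: equivclp_trans equivclp_sym)
qed

lemma realization_map_class:
  assumes "sset_map X Y \<phi>"
  shows "realization_map Y \<phi> (glue_class X ((n, x), t)) = glue_class Y ((n, \<phi> n x), t)"
proof -
  let ?F = "\<lambda>p. case p of ((n, x), t) \<Rightarrow> ((n, \<phi> n x), t)"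
  have stepY: "glue Y (?F p) (?F q)" if "glue X p q" for p q
    using that
  proof cases
    case (1 f m n x t)
    with assms show ?thesis
      by (auto simp: sset_map_def intro!: glue.intros)
  qed
  have "equivclp (glue Y) (?F p) (?F q)" if "equivclp (glue X) p q" for p q
    using that
  proof (induction rule: equivclp_induct)
    case (step y z)
    have "equivclp (glue Y) (?F y) (?F z)"
      using step(2)
    proof
      assume "glue X y z"
      then show ?thesis using stepY by (intro r_into_equivclp)
    next
      assume "glue X z y"
      then show ?thesis using stepY by (intro converse_r_into_equivclp)
    qed
    with step(3) show ?case by (rule equivclp_trans)
  qed simp
  then have eq: "glue_class Y (?F q) = glue_class Y (?F ((n, x), t))"
    if "q \<in> glue_class X ((n, x), t)" for q
    using that unfolding glue_class_eq_iff by (simp only: glue_class_def mem_Collect_eq equivclp_sym)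
  have "((n, x), t) \<in> glue_class X ((n, x), t)" by (simp add: glue_class_def)
  then have "(\<Union>q\<in>glue_class X ((n, x), t). glue_class Y (?F q)) = glue_class Y (?F ((n, x), t))"
    using eq by blast
  moreover have "realization_map Y \<phi> c = (\<Union>q\<in>c. glue_class Y (?F q))" for c
    unfolding realization_map_def by (rule SUP_cong) (simp_all split: prod.split)
  ultimately show ?thesis by simp
qed

lemma homotopy_group_map_class:
  assumes f: "continuous_map X Y f"
    and p: "continuous_map (nsphere n) X p" "p sphere_base = x"
  shows "homotopy_group_map n Y x f (pointed_homotopy_class n X x p) =
    pointed_homotopy_class n Y (f x) (f \<circ> p)"
proof -
  have eq: "pointed_homotopy_class n Y (f x) (f \<circ> q) = pointed_homotopy_class n Y (f x) (f \<circ> p)"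
    if "q \<in> pointed_homotopy_class n X x p" for q
  proof -
    have "homotopic_with (\<lambda>h. h sphere_base = x) (nsphere n) X p q"
      using that by (simp add: pointed_homotopy_class_def)
    then have "homotopic_with (\<lambda>h. h sphere_base = f x) (nsphere n) Y (f \<circ> p) (f \<circ> q)"
      by (rule homotopic_with_compose_continuous_map_left[OF _ f]) simp
    then show ?thesis
      unfolding pointed_homotopy_class_def by (blast intro: homotopic_with_trans homotopic_with_symD)
  qed
  have "p \<in> pointed_homotopy_class n X x p"
    using p by (simp add: pointed_homotopy_class_def homotopic_with_refl)
  then show ?thesis
    unfolding homotopy_group_map_def using eq by blast
qed

lemma path_components_map_class:
  assumes f: "continuous_map X Y f" and x: "x \<in> topspace X"
  shows "path_components_map Y f (path_component_of_set X x) = path_component_of_set Y (f x)"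
proof -
  have eq: "path_component_of_set Y (f y) = path_component_of_set Y (f x)"
    if y: "path_component_of X x y" for y
  proof -
    obtain g where g: "pathin X g" "g 0 = x" "g 1 = y"
      using y unfolding path_component_of_def by blast
    have "pathin Y (f \<circ> g)" by (rule pathin_compose[OF g(1) f])
    then have "path_component_of Y (f x) (f y)"
      unfolding path_component_of_def using g by (intro exI[of _ "f \<circ> g"]) simp
    then show ?thesis
      by (blast intro: path_component_of_trans path_component_of_sym)
  qed
  have "path_component_of X x x" using x by (simp add: path_component_of_refl)
  then show ?thesis unfolding path_components_map_def using eq by blast
qed

end

theory Submission
  imports Defs
begin

text \<open>
  Without \<open>C0\<close>, an edgewise subdivision identifies the realizations of \<open>T\<^sup>* X\<close> and \<open>X\<close> by a
  natural homeomorphism: a point with barycentric coordinates \<open>t\<close> in a simplex \<open>x\<close> of \<open>T\<^sup>* X\<close> goes to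
  the point of \<open>x\<close> (read as a simplex of \<open>X\<close>) that has a scaled copy of \<open>t\<close> in every block of
  \<open>[T m]\<close>, reversed in the blocks of \<open>Op\<close>. Injectivity holds because two weights of equal total
  mass have a common refinement, and a monotone map is determined by the push-forward of a positive
  weight. The inverse is continuous because finitely many compact pieces cover each simplex.

  If \<open>C0\<close> occurs in \<open>T\<close>, each \<open>[T m]\<close> has a vertex that is natural in \<open>m\<close>. It defines a map from
  \<open>T\<^sup>* X\<close> to the discrete set of vertices of \<open>X\<close>, so for the 1-simplex \<open>X\<close> the realization of
  \<open>T\<^sup>* X\<close> is disconnected, and \<open>T\<^sup>*\<close> does not preserve the weak equivalence from \<open>X\<close> to a point.
\<close>

section \<open>Weights on simplices and their push-forwards\<close>

text \<open>A summand \<open>Id\<close> or \<open>Op\<close> is a block into which a weight is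
  copied, so \<open>r\<close> counts the blocks and a weight of mass \<open>c\<close> spreads to
  mass \<open>r * c\<close>. Hence weights of arbitrary mass, with a division by \<open>r\<close>
  before returning to the standard simplex. Surjectivity needs work: a weight \<open>s\<close> of
  mass \<open>r * c\<close> must be the push-forward of a spread weight. Cutting \<open>s\<close>
  into consecutive pieces of mass \<open>c\<close> gives one piece per block, but each piece
  suggests its own weight on its own simplex. A common refinement reconciles them, so the same
  device serves existence and uniqueness. It also controls dimensions: a refinement of weights on
  \<open>[m]\<close> and \<open>[n]\<close> needs dimension at most \<open>m + n\<close>, and this
  is where the finiteness of the pieces comes from. Simplices are never reduced to nondegenerate
  ones. The comparison is made between two quotients of one space, the presentation space of the
  pullback. For the converse, simplices are elements of an arbitrary infinite type, so the 1-simplex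
  has to be encoded in it.\<close>

definition weights :: "real \<Rightarrow> nat \<Rightarrow> (nat \<Rightarrow> real) set" where
  "weights c m = {t. (\<forall>i. 0 \<le> t i) \<and> (\<forall>i>m. t i = 0) \<and> (\<Sum>i\<le>m. t i) = c}"

lemma weightsD:
  assumes "t \<in> weights c m"
  shows "0 \<le> t i" "m < i \<Longrightarrow> t i = 0" "(\<Sum>i\<le>m. t i) = c"
  using assms by (auto simp: weights_def)

lemma weights_le:
  assumes "t \<in> weights c m"
  shows "t i \<le> c"
proof (cases "i \<le> m")
  case True
  then have "t i \<le> (\<Sum>i\<le>m. t i)"
    using weightsD[OF assms] by (intro member_le_sum) auto
  then show ?thesis using weightsD[OF assms] by simp
next
  case False
  moreover have "0 \<le> (\<Sum>i\<le>m. t i)" using weightsD[OF assms] by (intro sum_nonneg) auto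
  ultimately show ?thesis using weightsD[OF assms] by simp
qed

lemma standard_simplex_eq_weights: "standard_simplex m = weights 1 m"
proof -
  have "t i \<le> 1" if "t \<in> weights 1 m" for t i using weights_le[OF that] .
  then show ?thesis by (fastforce simp: standard_simplex_def weights_def)
qed

lemma weights_scale: "t \<in> weights c m \<Longrightarrow> 0 \<le> a \<Longrightarrow> (\<lambda>i. a * t i) \<in> weights (a * c) m"
  by (auto simp: weights_def simp flip: sum_distrib_left)

lemma weights_drop:
  assumes "t \<in> weights c (Suc m)"
  shows "t(Suc m := 0) \<in> weights (c - t (Suc m)) m"
proof -
  have "(\<Sum>i\<le>m. (t(Suc m := 0)) i) = (\<Sum>i\<le>m. t i)" by (intro sum.cong) auto
  then show ?thesis using assms by (auto simp: weights_def)
qed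

lemma weights_lower_last:
  assumes "t \<in> weights c m" "a \<le> t m"
  shows "t(m := t m - a) \<in> weights (c - a) m"
proof -
  have "(\<Sum>i\<le>m. (t(m := t m - a)) i) = (\<Sum>i\<in>{..m} - {m}. t i) + (t m - a)"
    by (subst sum.remove[of _ m]) auto
  also have "\<dots> = (\<Sum>i\<le>m. t i) - a" by (subst (2) sum.remove[of _ m]) auto
  finally show ?thesis using assms by (auto simp: weights_def)
qed

lemma weights_append:
  assumes "w \<in> weights c k" "0 \<le> a"
  shows "w(Suc k := a) \<in> weights (c + a) (Suc k)"
proof -
  have "(\<Sum>i\<le>k. (w(Suc k := a)) i) = (\<Sum>i\<le>k. w i)" by (intro sum.cong) auto
  then show ?thesis using assms by (auto simp: weights_def)
qed

section \<open>Push-forward of weights along maps of vertices\<close>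

lemma simplex_push_if: "simplex_push m f t i = (\<Sum>j\<le>m. if f j = i then t j else 0)"
proof -
  have "{j. j \<le> m \<and> f j = i} = {..m} \<inter> {j. f j = i}" by auto
  then show ?thesis unfolding simplex_push_def by (simp add: sum.inter_restrict)
qed

lemma simplex_push_cong:
  assumes "\<And>j. j \<le> m \<Longrightarrow> f j = g j" "\<And>j. j \<le> m \<Longrightarrow> s j = t j"
  shows "simplex_push m f s = simplex_push m g t"
  using assms by (auto simp: simplex_push_if fun_eq_iff intro!: sum.cong)

lemma simplex_push_comp:
  assumes "\<And>j. j \<le> l \<Longrightarrow> f j \<le> m"
  shows "simplex_push m g (simplex_push l f t) = simplex_push l (\<lambda>j. g (f j)) t"
proof
  fix i
  have "simplex_push m g (simplex_push l f t) i =
      (\<Sum>j\<le>m. \<Sum>k\<le>l. if f k = j then (if g j = i then t k else 0) else 0)"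
    unfolding simplex_push_if by (auto intro!: sum.cong sum.neutral)
  also have "\<dots> = (\<Sum>k\<le>l. \<Sum>j\<le>m. if f k = j then (if g j = i then t k else 0) else 0)"
    by (rule sum.swap)
  also have "\<dots> = simplex_push l (\<lambda>j. g (f j)) t i"
    unfolding simplex_push_if using assms by (intro sum.cong) (auto simp: sum.delta')
  finally show "simplex_push m g (simplex_push l f t) i = simplex_push l (\<lambda>j. g (f j)) t i" .
qed

lemma simplex_push_simplex_comp:
  assumes "f \<in> simplex_hom l m"
  shows "simplex_push l (simplex_comp l g f) t = simplex_push m g (simplex_push l f t)"
  using simplex_homD[OF assms]
  by (subst simplex_push_comp) (auto simp: simplex_comp_def compose_def intro!: simplex_push_cong)

lemma simplex_push_weights:
  assumes f: "\<And>j. j \<le> m \<Longrightarrow> f j \<le> n" and t: "t \<in> weights c m"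
  shows "simplex_push m f t \<in> weights c n"
proof -
  have "(\<Sum>i\<le>n. simplex_push m f t i) = (\<Sum>j\<le>m. \<Sum>i\<le>n. if f j = i then t j else 0)"
    unfolding simplex_push_if by (rule sum.swap)
  also have "\<dots> = (\<Sum>j\<le>m. t j)" using f by (intro sum.cong) (auto simp: sum.delta')
  finally show ?thesis
    using weightsD[OF t] f
    by (fastforce simp: weights_def simplex_push_def intro!: sum_nonneg sum.neutral)
qed

lemma simplex_push_hom_weights:
  "f \<in> simplex_hom m n \<Longrightarrow> t \<in> weights c m \<Longrightarrow> simplex_push m f t \<in> weights c n"
  by (rule simplex_push_weights) (auto dest: simplex_homD)

text \<open>Only vertices that carry mass have to be fixed. This allows a vertex map to be changed
  to \<open>max l\<close> on a weight that vanishes below \<open>l\<close>.\<close>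

lemma simplex_push_id:
  assumes "t \<in> weights c m" "\<And>j. j \<le> m \<Longrightarrow> t j \<noteq> 0 \<Longrightarrow> f j = j"
  shows "simplex_push m f t = t"
proof
  fix i
  have "simplex_push m f t i = (\<Sum>j\<le>m. if i = j then t j else 0)"
    unfolding simplex_push_if
  proof (intro sum.cong refl)
    fix j assume "j \<in> {..m}"
    then show "(if f j = i then t j else 0) = (if i = j then t j else 0)"
      using assms(2)[of j] by (cases "t j = 0") auto
  qed
  also have "\<dots> = t i" using weightsD[OF assms(1)] by (auto simp: sum.delta)
  finally show "simplex_push m f t i = t i" .
qed

lemma simplex_push_scale:
  "simplex_push m f (\<lambda>i. a * t i) = (\<lambda>i. a * simplex_push m f t i)"
  by (auto simp: simplex_push_if fun_eq_iff sum_distrib_left intro!: sum.cong)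

lemma simplex_push_append:
  "simplex_push (Suc k) (f(Suc k := n)) (w(Suc k := a)) =
    (simplex_push k f w)(n := simplex_push k f w n + a)"
proof
  fix i
  have "(\<Sum>j\<le>k. if (f(Suc k := n)) j = i then (w(Suc k := a)) j else 0) =
    (\<Sum>j\<le>k. if f j = i then w j else 0)" by (intro sum.cong) auto
  then show "simplex_push (Suc k) (f(Suc k := n)) (w(Suc k := a)) i =
    ((simplex_push k f w)(n := simplex_push k f w n + a)) i"
    by (auto simp: simplex_push_if)
qed

lemma sum_atMost_split:
  fixes g :: "nat \<Rightarrow> real"
  shows "sum g {..a + b + 1} = sum g {..a} + (\<Sum>k\<le>b. g (a + 1 + k))"
proof -
  have "{..a + b + 1} = {..a} \<union> {a + 1..a + b + 1}" by auto
  then have "sum g {..a + b + 1} = sum g {..a} + sum g {a + 1..a + b + 1}"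
    by (simp add: sum.union_disjoint)
  also have "sum g {a + 1..a + b + 1} = (\<Sum>k\<le>b. g (a + 1 + k))"
    by (rule sum.reindex_bij_witness[of _ "\<lambda>k. a + 1 + k" "\<lambda>k. k - (a + 1)"]) auto
  finally show ?thesis .
qed

lemma simplex_push_split:
  "simplex_push (a + b + 1) h u i =
    simplex_push a h u i + simplex_push b (\<lambda>k. h (a + 1 + k)) (\<lambda>k. u (a + 1 + k)) i"
  by (simp only: simplex_push_if sum_atMost_split)

lemma simplex_hom_append:
  assumes "f \<in> simplex_hom k m" "m \<le> n"
  shows "f(Suc k := n) \<in> simplex_hom (Suc k) n"
proof -
  have "f j \<le> n" if "j \<le> k" for j using simplex_homD(1)[OF assms(1) that] assms(2) by simp
  then show ?thesis
    using assms(1) simplex_homD[OF assms(1)]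
    by (auto simp: simplex_hom_def mono_on_def PiE_iff extensional_def le_Suc_eq)
qed

lemma simplex_hom_mono:
  assumes "f \<in> simplex_hom k m" "m \<le> n"
  shows "f \<in> simplex_hom k n"
  using assms PiE_mono[of "{..k}" "\<lambda>_. {..m}" "\<lambda>_. {..n}"] by (auto simp: simplex_hom_def)

lemma restrict_in_simplex_hom:
  assumes "\<And>k. k \<le> m \<Longrightarrow> f k \<le> n" "\<And>j k. j \<le> k \<Longrightarrow> k \<le> m \<Longrightarrow> f j \<le> f k"
  shows "restrict f {..m} \<in> simplex_hom m n"
  using assms by (auto simp: simplex_hom_def mono_on_def)

lemma finite_simplex_hom: "finite (simplex_hom m n)"
  by (rule finite_subset[of _ "{..m} \<rightarrow>\<^sub>E {..n}"]) (auto simp: simplex_hom_def intro!: finite_PiE)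

text \<open>Placed on the chain of pairs \<open>(f j, g j)\<close> in the product of
  \<open>[m]\<close> and \<open>[n]\<close>, the weight \<open>w\<close> is a coupling with
  marginals \<open>s\<close> and \<open>t\<close>. Strict positivity of \<open>w\<close> is what
  makes monotone maps recoverable from push-forwards; the bound on \<open>k\<close> keeps the
  subdivision finite.\<close>

definition common_refinement :: "nat \<Rightarrow> (nat \<Rightarrow> real) \<Rightarrow> nat \<Rightarrow> (nat \<Rightarrow> real) \<Rightarrow> bool" where
  "common_refinement m s n t \<longleftrightarrow>
    (\<exists>k\<le>m + n. \<exists>w f g. f \<in> simplex_hom k m \<and> g \<in> simplex_hom k n \<and> (\<forall>j\<le>k. 0 < w j) \<and>
      (\<forall>j>k. w j = 0) \<and> simplex_push k f w = s \<and> simplex_push k g w = t)"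

lemma common_refinement_sym: "common_refinement m s n t \<Longrightarrow> common_refinement n t m s"
  unfolding common_refinement_def by (metis add.commute)

lemma common_refinement_mono:
  assumes "common_refinement m s n t" "m \<le> m'"
  shows "common_refinement m' s n t"
proof -
  have "k \<le> m' + n" if "k \<le> m + n" for k using that assms(2) by simp
  then show ?thesis
    using assms(1) simplex_hom_mono[OF _ assms(2)] unfolding common_refinement_def by blast
qed

text \<open>The new last vertex of the refinement lies over the pair \<open>(Suc m, n)\<close> and
  carries the mass \<open>s (Suc m)\<close> that was removed from both weights. One vertex is added
  for one unit of \<open>m\<close>, so the bound on \<open>k\<close> survives.\<close>

lemma common_refinement_step:
  assumes IH: "common_refinement m (s(Suc m := 0)) n (t(n := t n - s (Suc m)))"
    and pos: "0 < s (Suc m)"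
  shows "common_refinement (Suc m) s n t"
proof -
  let ?a = "s (Suc m)"
  obtain k w f g where k: "k \<le> m + n" and f: "f \<in> simplex_hom k m" and g: "g \<in> simplex_hom k n"
    and w: "\<forall>j\<le>k. 0 < w j" "\<forall>j>k. w j = 0"
    and fw: "simplex_push k f w = s(Suc m := 0)"
    and gw: "simplex_push k g w = t(n := t n - ?a)"
    using IH unfolding common_refinement_def by blast
  have "simplex_push (Suc k) (f(Suc k := Suc m)) (w(Suc k := ?a)) = s"
    "simplex_push (Suc k) (g(Suc k := n)) (w(Suc k := ?a)) = t"
    by (auto simp only: simplex_push_append fw gw) auto
  moreover have "f(Suc k := Suc m) \<in> simplex_hom (Suc k) (Suc m)"
    "g(Suc k := n) \<in> simplex_hom (Suc k) n"
    using simplex_hom_append[OF f, of "Suc m"] simplex_hom_append[OF g, of n] by auto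
  ultimately show ?thesis
    unfolding common_refinement_def using k w pos
    by (intro exI[of _ "Suc k"] conjI exI[of _ "w(Suc k := ?a)"] exI[of _ "f(Suc k := Suc m)"]
      exI[of _ "g(Suc k := n)"]) (auto simp: le_Suc_eq)
qed

text \<open>The last entries are compared and the smaller one is split off the larger, as in the
  northwest corner rule for transport problems.\<close>

lemma common_refinement_exists:
  assumes "s \<in> weights c m" "t \<in> weights c n" "0 < c"
  shows "common_refinement m s n t"
  using assms
proof (induction "m + n" arbitrary: m n s t c rule: less_induct)
  case less
  have drop: "\<exists>m'. m = Suc m'" if "s m \<noteq> c" "s \<in> weights c m" for s m
    using that by (cases m) (auto dest: weightsD(3))
  have zero: "common_refinement m s n t"
    if hyp: "s m = 0" "s \<in> weights c m" "t \<in> weights c n"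
      "\<And>m'. m = Suc m' \<Longrightarrow> s \<in> weights c m' \<Longrightarrow> common_refinement m' s n t" for s m t n
  proof -
    obtain m' where m: "m = Suc m'" using drop[of s m] hyp less.prems(3) by auto
    have "s(Suc m' := 0) = s" using hyp m by auto
    then have "s \<in> weights c m'" using weights_drop[of s c m'] hyp m by simp
    from common_refinement_mono[OF hyp(4)[OF m this]] show ?thesis using m by simp
  qed
  have step: "common_refinement m s n t"
    if st: "s m \<le> t n" "s m < c" "0 < s m" "s \<in> weights c m" "t \<in> weights c n"
      and IH: "\<And>m' s' t'. m = Suc m' \<Longrightarrow> s' \<in> weights (c - s m) m' \<Longrightarrow> t' \<in> weights (c - s m) n
        \<Longrightarrow> common_refinement m' s' n t'" for s m t n
  proof -
    obtain m' where m: "m = Suc m'" using drop[of s m] st by auto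
    have "common_refinement m' (s(Suc m' := 0)) n (t(n := t n - s (Suc m')))"
      by (rule IH[OF m]) (use st m weights_drop[of s c m'] weights_lower_last[of t c n "s m"] in simp_all)
    then show ?thesis unfolding m by (rule common_refinement_step) (use st(3) m in simp)
  qed
  \<comment> \<open>The recursion stops when both weights sit on their last vertex, where a single
    vertex is a refinement. Otherwise an empty last entry is dropped, or the smaller last entry is
    removed from both sides; it is less than \<open>c\<close>, so positive mass remains. Cases 2 and
    5 mirror 1 and 4.\<close>
  consider "s m = 0" | "t n = 0" | "s m = c" "t n = c" | "0 < s m" "s m \<le> t n" "s m < c"
    | "0 < t n" "t n \<le> s m" "t n < c"
    using weights_le[OF less.prems(1), of m] weights_le[OF less.prems(2), of n]
      weightsD(1)[OF less.prems(1), of m] weightsD(1)[OF less.prems(2), of n] by linarith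
  then show ?case
  proof cases
    case 1
    show ?thesis
      by (rule zero[OF 1 less.prems(1,2)], rule less.hyps) (use less.prems in auto)
  next
    case 2
    show ?thesis
      by (rule common_refinement_sym, rule zero[OF 2 less.prems(2,1)],
        rule common_refinement_sym, rule less.hyps) (use less.prems in auto)
  next
    case 3
    have single: "simplex_push 0 (\<lambda>j\<in>{..0}. m) (\<lambda>j. if j = 0 then c else 0) = s"
      if "s m = c" "s \<in> weights c m" for s m
    proof
      fix i
      have "s i = 0" if "i \<noteq> m"
      proof (cases "i < m")
        case True
        have "s i + s m \<le> (\<Sum>j\<le>m. s j)"
          using True weightsD[OF \<open>s \<in> weights c m\<close>] sum_mono2[of "{..m}" "{i, m}" s] by auto
        then show ?thesis
          using weightsD[OF \<open>s \<in> weights c m\<close>] \<open>s m = c\<close> by (simp add: order_antisym)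
      qed (use weightsD[OF \<open>s \<in> weights c m\<close>] that in auto)
      then show "simplex_push 0 (\<lambda>j\<in>{..0}. m) (\<lambda>j. if j = 0 then c else 0) i = s i"
        using \<open>s m = c\<close> by (cases "i = m") (simp_all add: simplex_push_if)
    qed
    have "(\<lambda>j\<in>{..0}. m) \<in> simplex_hom 0 m" for m by (rule restrict_in_simplex_hom) auto
    then show ?thesis
      unfolding common_refinement_def
      using single[OF 3(1) less.prems(1)] single[OF 3(2) less.prems(2)] less.prems(3)
      by (intro exI[of _ 0] conjI exI[of _ "\<lambda>j. if j = 0 then c else 0"]
        exI[of _ "\<lambda>j\<in>{..0}. m"] exI[of _ "\<lambda>j\<in>{..0}. n"]) simp_all
  next
    case 4
    show ?thesis
      by (rule step[OF 4(2,3,1) less.prems(1,2)], rule less.hyps[where c = "c - s m"]) (use 4 in auto)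
  next
    case 5
    show ?thesis
      by (rule common_refinement_sym, rule step[OF 5(2,3,1) less.prems(2,1)],
        rule common_refinement_sym, rule less.hyps[where c = "c - t n"]) (use 5 in auto)
  qed
qed

text \<open>Counted from the left, the first \<open>a\<close> units of mass end inside a vertex
  \<open>p\<close>, which the two pieces may share. An overlap in at most this vertex is what lets
  maps on two consecutive blocks be joined monotonically. The induction peels off last vertices,
  each reducing \<open>b\<close>, until one holds all that is left of \<open>b\<close>.\<close>

lemma weights_cut:
  assumes "s \<in> weights (a + b) n" "0 \<le> a" "0 \<le> b"
  shows "\<exists>p s' s''. p \<le> n \<and> s' \<in> weights a p \<and> s'' \<in> weights b n \<and> (\<forall>i<p. s'' i = 0) \<and>
    s = (\<lambda>i. s' i + s'' i)"
  using assms
proof (induction n arbitrary: s b)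
  case 0
  have "s = (\<lambda>i. (if i = 0 then a else 0) + (if i = 0 then b else 0))"
    using 0 by (auto simp: weights_def fun_eq_iff)
  moreover have "(\<lambda>i. if i = 0 then a else 0) \<in> weights a 0"
    "(\<lambda>i. if i = 0 then b else 0) \<in> weights b 0" using 0 by (auto simp: weights_def)
  ultimately show ?case by blast
next
  case (Suc n)
  show ?case
  proof (cases "b \<le> s (Suc n)")
    case True
    \<comment> \<open>The cut falls inside the last vertex, so \<open>p = Suc n\<close> and the
      second piece is concentrated there.\<close>
    have "s(Suc n := s (Suc n) - b) \<in> weights a (Suc n)"
      using weights_lower_last[OF Suc.prems(1) True] by simp
    moreover have "(\<lambda>i. if i = Suc n then b else 0) \<in> weights b (Suc n)"
      using Suc.prems by (auto simp: weights_def sum.delta)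
    moreover have "s = (\<lambda>i. (s(Suc n := s (Suc n) - b)) i + (if i = Suc n then b else 0))"
      by (simp add: fun_eq_iff)
    moreover have "\<forall>i<Suc n. (if i = Suc n then b else 0) = 0" by simp
    ultimately show ?thesis by blast
  next
    case False
    let ?x = "s (Suc n)"
    have cut: "s(Suc n := 0) \<in> weights (a + (b - ?x)) n"
      using weights_drop[OF Suc.prems(1)] by (simp add: algebra_simps)
    have "0 \<le> b - ?x" using False by simp
    from Suc.IH[OF cut Suc.prems(2) this]
    obtain p s' s'' where p: "p \<le> n" "s' \<in> weights a p" "s'' \<in> weights (b - ?x) n"
      "\<forall>i<p. s'' i = 0" "s(Suc n := 0) = (\<lambda>i. s' i + s'' i)" by blast
    have "s''(Suc n := ?x) \<in> weights b (Suc n)"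
      using weights_append[OF p(3), of ?x] weightsD(1)[OF Suc.prems(1)] by simp
    moreover have "s = (\<lambda>i. s' i + (s''(Suc n := ?x)) i)"
    proof
      fix i show "s i = s' i + (s''(Suc n := ?x)) i"
        using fun_cong[OF p(5), of i] weightsD(2)[OF p(2), of i] p(1) by (cases "i = Suc n") (simp_all split: if_splits)
    qed
    moreover have "p \<le> Suc n" "\<forall>i<p. (s''(Suc n := ?x)) i = 0" using p(1,4) by auto
    ultimately show ?thesis using p(2) by blast
  qed
qed

text \<open>A monotone map is recovered from the partial sums of the push-forward of positive weights.\<close>

lemma simplex_push_inj:
  assumes f: "f \<in> simplex_hom l n" and g: "g \<in> simplex_hom l n"
    and pos: "\<And>j. j \<le> l \<Longrightarrow> 0 < u j" and eq: "simplex_push l f u = simplex_push l g u"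
  shows "f = g"
proof -
  have *: "\<not> f k < g k" if f: "f \<in> simplex_hom l n" and g: "g \<in> simplex_hom l n" and k: "k \<le> l"
    and eq: "simplex_push l f u = simplex_push l g u" for f g k
  proof
    assume less: "f k < g k"
    have partial: "(\<Sum>i\<le>f k. simplex_push l h u i) = (\<Sum>j\<le>l. if h j \<le> f k then u j else 0)" for h
      unfolding simplex_push_if by (subst sum.swap) (auto intro!: sum.cong simp: sum.delta')
    \<comment> \<open>By monotonicity every \<open>j\<close> with \<open>g j \<le> f k\<close>
      precedes \<open>k\<close> and so satisfies \<open>f j \<le> f k\<close>. The index
      \<open>k\<close> itself satisfies only the latter, and its positive mass makes the inequality
      strict.\<close>
    have "(\<Sum>j\<le>l. if g j \<le> f k then u j else 0) < (\<Sum>j\<le>l. if f j \<le> f k then u j else 0)"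
    proof (rule sum_strict_mono_ex1)
      show "\<forall>j\<in>{..l}. (if g j \<le> f k then u j else 0) \<le> (if f j \<le> f k then u j else 0)"
      proof
        fix j assume j: "j \<in> {..l}"
        have "f j \<le> f k" if "g j \<le> f k"
        proof -
          have "\<not> k \<le> j" using simplex_homD(2)[OF g, of k j] that less j by auto
          then show ?thesis using simplex_homD(2)[OF f, of j k] k by simp
        qed
        then show "(if g j \<le> f k then u j else 0) \<le> (if f j \<le> f k then u j else 0)"
          using pos[of j] j by (auto intro: less_imp_le)
      qed
      show "\<exists>j\<in>{..l}. (if g j \<le> f k then u j else 0) < (if f j \<le> f k then u j else 0)"
        using less k pos by (intro bexI[of _ k]) auto
    qed simp
    then show False using partial[of f] partial[of g] eq by simp
  qed
  have "f k = g k" if "k \<le> l" for k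
    using *[OF f g that eq] *[OF g f that eq[symmetric]] by simp
  moreover have "f k = g k" if "\<not> k \<le> l" for k
    using f g that by (auto simp: simplex_hom_def PiE_iff extensional_def)
  ultimately show ?thesis by blast
qed

section \<open>Endofunctors that subdivide simplices\<close>

text \<open>For a sum \<open>T\<close> of copies of \<open>Id\<close> and \<open>Op\<close>, every vertex of \<open>[T m]\<close> lies over a vertex of
  \<open>[m]\<close>, and a weight on \<open>[m]\<close> is spread over \<open>[T m]\<close> by copying it into every block.\<close>

definition spread :: "simplex_functor \<Rightarrow> (nat \<Rightarrow> nat \<Rightarrow> nat) \<Rightarrow> nat \<Rightarrow> (nat \<Rightarrow> real) \<Rightarrow> nat \<Rightarrow> real"
  where "spread T \<pi> m t = (\<lambda>k. if k \<le> obj T m then t (\<pi> m k) else 0)"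

text \<open>The bound \<open>b\<close> in the last assumption makes the subdivision of a simplex finite.\<close>

locale folding =
  fixes T :: simplex_functor and r :: real and \<pi> :: "nat \<Rightarrow> nat \<Rightarrow> nat"
  assumes endofunctor: "is_endofunctor T"
    and r_pos: "0 < r"
    and fold_le: "\<And>m k. k \<le> obj T m \<Longrightarrow> \<pi> m k \<le> m"
    and spread_sum: "\<And>m t. (\<Sum>k\<in>{..obj T m}. t (\<pi> m k)) = r * (\<Sum>j\<le>m. t j)"
    and spread_push: "\<And>m n f t. f \<in> simplex_hom m n \<Longrightarrow>
      spread T \<pi> n (simplex_push m f t) = simplex_push (obj T m) (mor T m n f) (spread T \<pi> m t)"
    and spread_exists: "\<And>n. \<exists>b. \<forall>c s. 0 < c \<longrightarrow> s \<in> weights (r * c) n \<longrightarrow>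
      (\<exists>m\<le>b. \<exists>f\<in>simplex_hom (obj T m) n. \<exists>t\<in>weights c m.
        simplex_push (obj T m) f (spread T \<pi> m t) = s)"

lemma simplex_push_outside:
  assumes "f \<in> simplex_hom m n" "n < i"
  shows "simplex_push m f t i = 0"
proof -
  have "f j \<noteq> i" if "j \<le> m" for j using simplex_homD(1)[OF assms(1) that] assms(2) by simp
  then show ?thesis by (simp add: simplex_push_if)
qed

section \<open>The folding axioms for single blocks and for sums\<close>

lemma folding_Id: "folding Id_functor 1 (\<lambda>m k. k)"
proof
  show "is_endofunctor Id_functor" by (rule is_endofunctor_Id)
next
  fix m n f and t :: "nat \<Rightarrow> real"
  assume f: "f \<in> simplex_hom m n"
  have "simplex_push m f (spread Id_functor (\<lambda>m k. k) m t) = simplex_push m f t"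
    by (rule simplex_push_cong) (auto simp: spread_def Id_functor_def)
  then show "spread Id_functor (\<lambda>m k. k) n (simplex_push m f t) =
      simplex_push (obj Id_functor m) (mor Id_functor m n f) (spread Id_functor (\<lambda>m k. k) m t)"
    using f simplex_push_outside[OF f] by (auto simp: spread_def Id_functor_def fun_eq_iff)
next
  fix n
  have "\<exists>f\<in>simplex_hom n n. \<exists>t\<in>weights c n.
      simplex_push n f (spread Id_functor (\<lambda>m k. k) n t) = s" if s: "s \<in> weights c n" for c s
  proof (intro bexI)
    have "spread Id_functor (\<lambda>m k. k) n s = s"
      using weightsD(2)[OF s] by (auto simp: spread_def Id_functor_def fun_eq_iff)
    moreover have "simplex_push n (simplex_id n) s = s"
      by (rule simplex_push_id[OF s]) (simp add: simplex_id_def)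
    ultimately show "simplex_push n (simplex_id n) (spread Id_functor (\<lambda>m k. k) n s) = s" by simp
  qed (use s simplex_id_in_hom in auto)
  then show "\<exists>b. \<forall>c s. 0 < c \<longrightarrow> s \<in> weights (1 * c) n \<longrightarrow>
      (\<exists>m\<le>b. \<exists>f\<in>simplex_hom (obj Id_functor m) n. \<exists>t\<in>weights c m.
        simplex_push (obj Id_functor m) f (spread Id_functor (\<lambda>m k. k) m t) = s)"
    by (intro exI[of _ n]) (auto simp: Id_functor_def)
qed (auto simp: Id_functor_def)

lemma sum_atMost_reverse: "(\<Sum>k\<le>m. g (m - k)) = (\<Sum>k\<le>m. g k)" for m :: nat
  by (rule sum.reindex_bij_witness[of _ "\<lambda>k. m - k" "\<lambda>k. m - k"]) auto

lemma folding_Op: "folding Op_functor 1 (\<lambda>m k. m - k)"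
proof
  show "is_endofunctor Op_functor" by (rule is_endofunctor_Op)
next
  fix m n f and t :: "nat \<Rightarrow> real"
  assume f: "f \<in> simplex_hom m n"
  let ?f = "\<lambda>k\<in>{..m}. n - f (m - k)"
  have Opf: "?f \<in> simplex_hom m n"
    using simplex_homD[OF f] by (intro restrict_in_simplex_hom) (auto intro!: diff_le_mono2)
  \<comment> \<open>For \<open>i \<le> n\<close>, \<open>n - f (m - k) = i\<close> is equivalent to
    \<open>f (m - k) = n - i\<close>; truncated subtraction breaks this for larger \<open>i\<close>,
    where both sides of the goal vanish anyway.\<close>
  have "simplex_push m ?f (\<lambda>k. if k \<le> m then t (m - k) else 0) i = simplex_push m f t (n - i)"
    if "i \<le> n" for i
  proof -
    have "simplex_push m ?f (\<lambda>k. if k \<le> m then t (m - k) else 0) i =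
        (\<Sum>k\<le>m. (\<lambda>j. if f j = n - i then t j else 0) (m - k))"
      unfolding simplex_push_if
    proof (intro sum.cong refl)
      fix k assume "k \<in> {..m}"
      then show "(if ?f k = i then if k \<le> m then t (m - k) else 0 else 0) =
          (\<lambda>j. if f j = n - i then t j else 0) (m - k)"
        using simplex_homD(1)[OF f, of "m - k"] that by auto
    qed
    also have "\<dots> = simplex_push m f t (n - i)"
      by (subst sum_atMost_reverse) (rule simplex_push_if[symmetric])
    finally show ?thesis .
  qed
  then show "spread Op_functor (\<lambda>m k. m - k) n (simplex_push m f t) =
      simplex_push (obj Op_functor m) (mor Op_functor m n f) (spread Op_functor (\<lambda>m k. m - k) m t)"
    using f simplex_push_outside[OF Opf] by (auto simp: spread_def Op_functor_def fun_eq_iff)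
next
  fix n
  have "\<exists>f\<in>simplex_hom n n. \<exists>t\<in>weights c n.
      simplex_push n f (spread Op_functor (\<lambda>m k. m - k) n t) = s" if s: "s \<in> weights c n" for c s
  proof (intro bexI)
    let ?t = "\<lambda>k. if k \<le> n then s (n - k) else 0"
    have "spread Op_functor (\<lambda>m k. m - k) n ?t = s"
      using weightsD(2)[OF s] by (auto simp: spread_def Op_functor_def fun_eq_iff)
    moreover have "simplex_push n (simplex_id n) s = s"
      by (rule simplex_push_id[OF s]) (simp add: simplex_id_def)
    ultimately show
      "simplex_push n (simplex_id n) (spread Op_functor (\<lambda>m k. m - k) n ?t) = s" by simp
    have "(\<Sum>k\<le>n. ?t k) = (\<Sum>k\<le>n. s (n - k))" by (intro sum.cong) auto
    then show "?t \<in> weights c n"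
      using s sum_atMost_reverse[of s n] by (auto simp: weights_def)
  qed (use simplex_id_in_hom in auto)
  then show "\<exists>b. \<forall>c s. 0 < c \<longrightarrow> s \<in> weights (1 * c) n \<longrightarrow>
      (\<exists>m\<le>b. \<exists>f\<in>simplex_hom (obj Op_functor m) n. \<exists>t\<in>weights c m.
        simplex_push (obj Op_functor m) f (spread Op_functor (\<lambda>m k. m - k) m t) = s)"
    by (intro exI[of _ n]) (auto simp: Op_functor_def)
next
  fix m and t :: "nat \<Rightarrow> real"
  show "(\<Sum>k\<in>{..obj Op_functor m}. t (m - k)) = 1 * (\<Sum>j\<le>m. t j)"
    using sum_atMost_reverse[of t m] by (simp add: Op_functor_def)
qed (auto simp: Op_functor_def)

lemma mor_in_simplex_hom:
  "is_endofunctor T \<Longrightarrow> f \<in> simplex_hom m n \<Longrightarrow> mor T m n f \<in> simplex_hom (obj T m) (obj T n)"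
  by (simp add: is_endofunctor_def)

lemma simplex_push_shift:
  "simplex_push m (\<lambda>k. a + 1 + f k) t i = (if i \<le> a then 0 else simplex_push m f t (i - a - 1))"
  by (auto simp: simplex_push_if intro!: sum.cong sum.neutral)

text \<open>Block counts add. For existence, \<open>s\<close> is cut into masses
  \<open>p * c\<close> and \<open>q * c\<close>, and each summand reaches its piece from a weight of
  mass \<open>c\<close>. Having equal mass, these two weights have a common refinement
  \<open>w\<close>, and naturality of spreading lets \<open>w\<close> replace both.\<close>

lemma folding_add:
  assumes "folding S p \<pi>" "folding T q \<rho>"
  defines "\<sigma> \<equiv> \<lambda>m k. if k \<le> obj S m then \<pi> m k else \<rho> m (k - obj S m - 1)"
  shows "folding (functor_add S T) (p + q) \<sigma>"
proof -
  interpret S: folding S p \<pi> by fact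
  interpret T: folding T q \<rho> by fact
  let ?U = "functor_add S T"
  have obj: "obj ?U m = obj S m + obj T m + 1" for m by (simp add: functor_add_def)
  have spread_low: "spread ?U \<sigma> m t k = spread S \<pi> m t k" if "k \<le> obj S m" for m t k
    using that by (simp add: spread_def obj \<sigma>_def)
  have spread_high: "spread ?U \<sigma> m t (obj S m + 1 + k) = spread T \<rho> m t k" for m t k
    by (simp add: spread_def obj \<sigma>_def)
  have push: "simplex_push (obj ?U m) h (spread ?U \<sigma> m t) i =
      simplex_push (obj S m) h (spread S \<pi> m t) i +
      simplex_push (obj T m) (\<lambda>k. h (obj S m + 1 + k)) (spread T \<rho> m t) i" for m h t i
  proof -
    have "simplex_push (obj S m) h (spread ?U \<sigma> m t) = simplex_push (obj S m) h (spread S \<pi> m t)"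
      by (rule simplex_push_cong) (simp_all add: spread_low)
    then show ?thesis unfolding obj simplex_push_split spread_high by simp
  qed
  show ?thesis
  proof
    show "is_endofunctor ?U"
      by (rule is_endofunctor_add[OF S.endofunctor T.endofunctor])
    show "0 < p + q" using S.r_pos T.r_pos by simp
    show "\<sigma> m k \<le> m" if "k \<le> obj ?U m" for m k
      using that S.fold_le T.fold_le[of "k - obj S m - 1" m] by (auto simp: \<sigma>_def obj)
  next
    fix m and t :: "nat \<Rightarrow> real"
    have "(\<Sum>k\<in>{..obj S m}. t (\<sigma> m k)) = (\<Sum>k\<in>{..obj S m}. t (\<pi> m k))"
      by (intro sum.cong) (auto simp: \<sigma>_def)
    moreover have "(\<Sum>k\<in>{..obj T m}. t (\<sigma> m (obj S m + 1 + k))) = (\<Sum>k\<in>{..obj T m}. t (\<rho> m k))"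
      by (intro sum.cong) (auto simp: \<sigma>_def)
    ultimately show "(\<Sum>k\<in>{..obj ?U m}. t (\<sigma> m k)) = (p + q) * (\<Sum>j\<le>m. t j)"
      by (simp only: obj sum_atMost_split S.spread_sum T.spread_sum distrib_right)
  next
    fix m n f and t :: "nat \<Rightarrow> real"
    assume f: "f \<in> simplex_hom m n"
    let ?F = "mor S m n f" and ?G = "mor T m n f" and ?H = "mor ?U m n f"
    have F: "?F \<in> simplex_hom (obj S m) (obj S n)"
      by (rule mor_in_simplex_hom[OF S.endofunctor f])
    have H: "?H k = (if k \<le> obj S m then ?F k else obj S n + 1 + ?G (k - obj S m - 1))"
      if "k \<le> obj ?U m" for k
      using that f by (simp add: functor_add_def concat_map_def)
    have low: "simplex_push (obj S m) ?H (spread S \<pi> m t) = spread S \<pi> n (simplex_push m f t)"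
      unfolding S.spread_push[OF f] by (rule simplex_push_cong) (auto simp: H obj)
    have "simplex_push (obj T m) (\<lambda>k. ?H (obj S m + 1 + k)) (spread T \<rho> m t) =
        simplex_push (obj T m) (\<lambda>k. obj S n + 1 + ?G k) (spread T \<rho> m t)"
      by (rule simplex_push_cong) (auto simp: H obj)
    then have high: "simplex_push (obj T m) (\<lambda>k. ?H (obj S m + 1 + k)) (spread T \<rho> m t) i =
        (if i \<le> obj S n then 0 else spread T \<rho> n (simplex_push m f t) (i - obj S n - 1))" for i
      by (simp only: simplex_push_shift T.spread_push[OF f])
    show "spread ?U \<sigma> n (simplex_push m f t) =
        simplex_push (obj ?U m) ?H (spread ?U \<sigma> m t)"
    proof
      fix i
      have "spread ?U \<sigma> n (simplex_push m f t) i =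
          (if i \<le> obj S n then spread S \<pi> n (simplex_push m f t) i
           else spread T \<rho> n (simplex_push m f t) (i - obj S n - 1))"
        using spread_low[of i n] spread_high[of n _ "i - obj S n - 1"] by auto
      moreover have "spread S \<pi> n (simplex_push m f t) i = 0" if "\<not> i \<le> obj S n"
        using that by (simp add: spread_def)
      ultimately show "spread ?U \<sigma> n (simplex_push m f t) i =
          simplex_push (obj ?U m) ?H (spread ?U \<sigma> m t) i"
        unfolding push low high by simp
    qed
  next
    fix n
    \<comment> \<open>The first piece ends at a vertex \<open>l\<close> that depends on
      \<open>s\<close>, and its vertex map must stay below \<open>l\<close>. Taking the maximum over
      \<open>l \<le> n\<close> gives a bound independent of \<open>s\<close>.\<close>
    obtain b where b: "\<And>c s l. l \<le> n \<Longrightarrow> 0 < c \<Longrightarrow> s \<in> weights (p * c) l \<Longrightarrow>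
      \<exists>m\<le>b. \<exists>f\<in>simplex_hom (obj S m) l. \<exists>t\<in>weights c m.
        simplex_push (obj S m) f (spread S \<pi> m t) = s"
    proof -
      obtain b where b: "\<And>l c s. 0 < c \<Longrightarrow> s \<in> weights (p * c) l \<Longrightarrow>
        \<exists>m\<le>b l. \<exists>f\<in>simplex_hom (obj S m) l. \<exists>t\<in>weights c m.
          simplex_push (obj S m) f (spread S \<pi> m t) = s"
        using S.spread_exists by metis
      have "b l \<le> Max (b ` {..n})" if "l \<le> n" for l using that by simp
      then show ?thesis using b that[of "Max (b ` {..n})"] by (meson le_trans)
    qed
    obtain b' where b': "\<And>c s. 0 < c \<Longrightarrow> s \<in> weights (q * c) n \<Longrightarrow>
      \<exists>m\<le>b'. \<exists>f\<in>simplex_hom (obj T m) n. \<exists>t\<in>weights c m.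
        simplex_push (obj T m) f (spread T \<rho> m t) = s"
      using T.spread_exists by metis
    have "\<exists>m\<le>b + b'. \<exists>f\<in>simplex_hom (obj ?U m) n. \<exists>t\<in>weights c m.
        simplex_push (obj ?U m) f (spread ?U \<sigma> m t) = s"
      if c: "0 < c" and s: "s \<in> weights ((p + q) * c) n" for c s
    proof -
      have "s \<in> weights (p * c + q * c) n" using s by (simp add: distrib_right)
      from weights_cut[OF this] obtain l s1 s2 where l: "l \<le> n" and s1: "s1 \<in> weights (p * c) l"
        and s2: "s2 \<in> weights (q * c) n" "\<And>i. i < l \<Longrightarrow> s2 i = 0"
        and s_eq: "s = (\<lambda>i. s1 i + s2 i)"
        using c S.r_pos T.r_pos by auto
      obtain m1 f1 t1 where m1: "m1 \<le> b" "f1 \<in> simplex_hom (obj S m1) l" "t1 \<in> weights c m1"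
        "simplex_push (obj S m1) f1 (spread S \<pi> m1 t1) = s1"
        using b[OF l c s1] by blast
      obtain m2 f2 t2 where m2: "m2 \<le> b'" "f2 \<in> simplex_hom (obj T m2) n" "t2 \<in> weights c m2"
        "simplex_push (obj T m2) f2 (spread T \<rho> m2 t2) = s2"
        using b'[OF c s2(1)] by blast
      obtain k w g1 g2 where k: "k \<le> m1 + m2" and g: "g1 \<in> simplex_hom k m1" "g2 \<in> simplex_hom k m2"
        and pos: "\<forall>j\<le>k. 0 < w j" "\<forall>j>k. w j = 0"
        and w1: "simplex_push k g1 w = t1" and w2: "simplex_push k g2 w = t2"
        using common_refinement_exists[OF m1(3) m2(3) c] unfolding common_refinement_def by blast
      have w: "w \<in> weights c k"
      proof -
        have "0 \<le> w j" for j using pos by (cases "j \<le> k") (auto simp: less_imp_le)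
        then have "w \<in> weights (\<Sum>j\<le>k. w j) k" using pos by (simp add: weights_def)
        moreover from simplex_push_hom_weights[OF g(1) this] have "(\<Sum>j\<le>k. w j) = c"
          unfolding w1 using m1(3) by (simp add: weights_def)
        ultimately show ?thesis by simp
      qed
      \<comment> \<open>Composing with the images of \<open>g1\<close> and \<open>g2\<close> under
        \<open>S\<close> and \<open>T\<close> moves both presentations to the one weight
        \<open>w\<close>: pushing the spread of \<open>w\<close> along these images gives the
        spreads of \<open>t1\<close> and \<open>t2\<close>.\<close>
      define F where "F = simplex_comp (obj S k) f1 (mor S k m1 g1)"
      define G where "G = simplex_comp (obj T k) f2 (mor T k m2 g2)"
      have G1: "mor S k m1 g1 \<in> simplex_hom (obj S k) (obj S m1)"
        and G2: "mor T k m2 g2 \<in> simplex_hom (obj T k) (obj T m2)"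
        using mor_in_simplex_hom S.endofunctor T.endofunctor g by auto
      have F: "F \<in> simplex_hom (obj S k) l" and G: "G \<in> simplex_hom (obj T k) n"
        unfolding F_def G_def using simplex_comp_in_hom G1 G2 m1(2) m2(2) by auto
      have pF: "simplex_push (obj S k) F (spread S \<pi> k w) = s1"
        unfolding F_def simplex_push_simplex_comp[OF G1] S.spread_push[OF g(1), symmetric] w1 m1(4) ..
      have pG: "simplex_push (obj T k) G (spread T \<rho> k w) = s2"
        unfolding G_def simplex_push_simplex_comp[OF G2] T.spread_push[OF g(2), symmetric] w2 m2(4) ..
      \<comment> \<open>\<open>s2\<close> vanishes below \<open>l\<close>, so \<open>G\<close> may be raised to \<open>max l \<circ> G\<close>, which makes the
        juxtaposition of \<open>F\<close> and \<open>G\<close> monotone.\<close>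
      define H where "H = (\<lambda>j\<in>{..obj ?U k}. if j \<le> obj S k then F j else max l (G (j - obj S k - 1)))"
      have H: "H \<in> simplex_hom (obj ?U k) n"
        unfolding H_def
      proof (rule restrict_in_simplex_hom)
        fix j assume "j \<le> obj ?U k"
        then show "(if j \<le> obj S k then F j else max l (G (j - obj S k - 1))) \<le> n"
          using simplex_homD(1)[OF F, of j] simplex_homD(1)[OF G, of "j - obj S k - 1"] l
          by (auto simp: obj)
      next
        fix i j assume "i \<le> j" "j \<le> obj ?U k"
        then show "(if i \<le> obj S k then F i else max l (G (i - obj S k - 1))) \<le>
            (if j \<le> obj S k then F j else max l (G (j - obj S k - 1)))"
          using simplex_homD(1)[OF F, of i] simplex_homD(2)[OF F, of i j]
            simplex_homD(2)[OF G, of "i - obj S k - 1" "j - obj S k - 1"]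
          by (auto simp: obj le_max_iff_disj diff_le_mono le_diff_conv)
      qed
      have HF: "simplex_push (obj S k) H (spread S \<pi> k w) = s1"
        unfolding pF[symmetric] by (rule simplex_push_cong) (auto simp: H_def obj)
      have "simplex_push (obj T k) (\<lambda>j. H (obj S k + 1 + j)) (spread T \<rho> k w) =
          simplex_push (obj T k) (\<lambda>j. max l (G j)) (spread T \<rho> k w)"
        by (rule simplex_push_cong) (auto simp: H_def obj)
      also have "\<dots> = simplex_push n (max l) s2"
        unfolding pG[symmetric] using simplex_homD(1)[OF G] by (subst simplex_push_comp) auto
      also have "\<dots> = s2"
        using s2(2) by (intro simplex_push_id[OF s2(1)]) (auto simp: max_def not_le)
      finally have HG: "simplex_push (obj T k) (\<lambda>j. H (obj S k + 1 + j)) (spread T \<rho> k w) = s2" .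
      have "simplex_push (obj ?U k) H (spread ?U \<sigma> k w) = s"
        unfolding fun_eq_iff push HF HG s_eq by simp
      moreover have "k \<le> b + b'" using k m1(1) m2(1) by simp
      ultimately show ?thesis using H w by blast
    qed
    then show "\<exists>b. \<forall>c s. 0 < c \<longrightarrow> s \<in> weights ((p + q) * c) n \<longrightarrow>
        (\<exists>m\<le>b. \<exists>f\<in>simplex_hom (obj ?U m) n. \<exists>t\<in>weights c m.
          simplex_push (obj ?U m) f (spread ?U \<sigma> m t) = s)" by blast
  qed
qed

lemma folding_functor_sum:
  assumes "\<And>i. i \<le> n \<Longrightarrow> B i \<in> {Id_functor, Op_functor}"
  shows "\<exists>r \<pi>. folding (functor_sum B n) r \<pi>"
  using assms
proof (induction n)
  case 0
  then have "B 0 = Id_functor \<or> B 0 = Op_functor" by simp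
  then show ?case by (elim disjE) (use folding_Id folding_Op in \<open>auto intro!: exI\<close>)
next
  case (Suc n)
  then obtain r \<pi> where "folding (functor_sum B n) r \<pi>" by auto
  note add = folding_add[OF this]
  have "B (Suc n) = Id_functor \<or> B (Suc n) = Op_functor" using Suc.prems by simp
  then show ?case
    by (elim disjE) (use add[OF folding_Id] add[OF folding_Op] in \<open>auto intro!: exI\<close>)
qed

section \<open>The subdivision homeomorphism\<close>

lemma continuous_map_from_sum_topology:
  assumes "\<And>i. i \<in> I \<Longrightarrow> continuous_map (X i) Z (\<lambda>t. f (i, t))"
  shows "continuous_map (sum_topology X I) Z f"
  unfolding continuous_map_def
proof (intro conjI allI impI)
  show "f \<in> topspace (sum_topology X I) \<rightarrow> topspace Z"
    using continuous_map_image_subset_topspace[OF assms] by fastforce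
  fix U assume U: "openin Z U"
  show "openin (sum_topology X I) {p \<in> topspace (sum_topology X I). f p \<in> U}"
    unfolding openin_sum_topology
  proof (intro conjI ballI)
    fix i assume i: "i \<in> I"
    have "{t. (i, t) \<in> {p \<in> topspace (sum_topology X I). f p \<in> U}} =
        {t \<in> topspace (X i). f (i, t) \<in> U}" using i by auto
    then show "openin (X i) {t. (i, t) \<in> {p \<in> topspace (sum_topology X I). f p \<in> U}}"
      using assms[OF i] U by (simp add: continuous_map_def)
  qed auto
qed

text \<open>Each quotient map factors continuously through the other, so no inverse has to be
  written down. The formula for \<open>h\<close> on classes is recorded because naturality of the
  homeomorphism is read off from it.\<close>

lemma homeomorphic_maps_quotients:
  assumes f: "quotient_map X Y f" and g: "quotient_map X Z g"
    and eq: "\<And>x y. x \<in> topspace X \<Longrightarrow> y \<in> topspace X \<Longrightarrow> f x = f y \<longleftrightarrow> g x = g y"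
  shows "\<exists>h k. homeomorphic_maps Y Z h k \<and> (\<forall>x \<in> topspace X. h (f x) = g x)"
proof -
  obtain h where h: "continuous_map Y Z h" "\<And>x. x \<in> topspace X \<Longrightarrow> h (f x) = g x"
    using quotient_map_lift_exists[OF f quotient_imp_continuous_map[OF g]] eq by metis
  obtain k where k: "continuous_map Z Y k" "\<And>x. x \<in> topspace X \<Longrightarrow> k (g x) = f x"
    using quotient_map_lift_exists[OF g quotient_imp_continuous_map[OF f]] eq by metis
  have "topspace Y = f ` topspace X" "topspace Z = g ` topspace X"
    using f g by (auto simp: quotient_map_def)
  then have "homeomorphic_maps Y Z h k"
    unfolding homeomorphic_maps_def using h k by auto
  then show ?thesis using h(2) by blast
qed

abbreviation simplex_top :: "nat \<Rightarrow> (nat \<Rightarrow> real) topology" where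
  "simplex_top n \<equiv> subtopology (powertop_real UNIV) (standard_simplex n)"

lemma continuous_map_component_simplex_top:
  "continuous_map (simplex_top n) euclideanreal (\<lambda>t. t i)"
  by (intro continuous_map_from_subtopology continuous_map_product_projection) simp

lemma continuous_map_simplex_push:
  "continuous_map (simplex_top m) (powertop_real UNIV) (simplex_push m f)"
  unfolding continuous_map_componentwise_UNIV
proof
  fix i
  have "continuous_map (simplex_top m) euclideanreal (\<lambda>t. \<Sum>j | j \<le> m \<and> f j = i. t j)"
    by (intro continuous_map_sum continuous_map_component_simplex_top) simp
  then show "continuous_map (simplex_top m) euclideanreal (\<lambda>t. simplex_push m f t i)"
    by (simp add: simplex_push_def)
qed

lemma simplex_push_standard_simplex:
  "f \<in> simplex_hom m n \<Longrightarrow> t \<in> standard_simplex m \<Longrightarrow> simplex_push m f t \<in> standard_simplex n"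
  unfolding standard_simplex_eq_weights by (rule simplex_push_hom_weights)

lemma simplicial_setD:
  assumes "simplicial_set X"
  shows "f \<in> simplex_hom m n \<Longrightarrow> x \<in> simplices X n \<Longrightarrow> act X m n f x \<in> simplices X m"
    "x \<in> simplices X n \<Longrightarrow> act X n n (simplex_id n) x = x"
    "f \<in> simplex_hom l m \<Longrightarrow> g \<in> simplex_hom m n \<Longrightarrow> x \<in> simplices X n \<Longrightarrow>
      act X l n (simplex_comp l g f) x = act X l m f (act X m n g x)"
  using assms by (auto simp: simplicial_set_def)

lemma glue_class_act:
  assumes "f \<in> simplex_hom m n" "x \<in> simplices X n" "t \<in> standard_simplex m"
  shows "glue_class X ((m, act X m n f x), t) = glue_class X ((n, x), simplex_push m f t)"
  unfolding glue_class_eq_iff by (intro r_into_equivclp glue.intros assms)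

lemma continuous_map_simplex_to_realization:
  assumes "x \<in> simplices X n"
  shows "continuous_map (simplex_top n) (realization X) (\<lambda>t. glue_class X ((n, x), t))"
proof -
  have "continuous_map (simplex_top n) (presentation_space X) (\<lambda>t. ((n, x), t))"
    using continuous_map_component_injection[of "(n, x)" "SIGMA n:UNIV. simplices X n"
        "\<lambda>(n, x). simplex_top n"] assms
    by (simp add: presentation_space_def)
  from continuous_map_compose[OF this quotient_imp_continuous_map[OF quotient_map_realization]]
  show ?thesis by (simp add: o_def)
qed

lemma equivclp_glue_invariant:
  assumes "equivclp (glue X) p q" "\<And>p q. glue X p q \<Longrightarrow> F p = F q"
  shows "F p = F q"
  using assms(1) by (induction rule: equivclp_induct) (metis assms(2))+

section \<open>Comparison of the two realizations for a folding functor\<close>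

context folding
begin

definition normal_spread :: "nat \<Rightarrow> (nat \<Rightarrow> real) \<Rightarrow> nat \<Rightarrow> real" where
  "normal_spread m t = (\<lambda>k. inverse r * spread T \<pi> m t k)"

lemma spread_weights:
  assumes "t \<in> weights c m"
  shows "spread T \<pi> m t \<in> weights (r * c) (obj T m)"
proof -
  have "(\<Sum>k\<in>{..obj T m}. spread T \<pi> m t k) = (\<Sum>k\<in>{..obj T m}. t (\<pi> m k))"
    by (intro sum.cong) (auto simp: spread_def)
  then show ?thesis using spread_sum assms by (auto simp: weights_def spread_def)
qed

lemma normal_spread_standard_simplex:
  assumes "t \<in> standard_simplex m"
  shows "normal_spread m t \<in> standard_simplex (obj T m)"
  using weights_scale[OF spread_weights, of t 1 m "inverse r"] assms r_pos
  by (simp add: standard_simplex_eq_weights normal_spread_def)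

lemma normal_spread_push:
  assumes "f \<in> simplex_hom m n"
  shows "normal_spread n (simplex_push m f t) =
    simplex_push (obj T m) (mor T m n f) (normal_spread m t)"
  by (simp add: normal_spread_def simplex_push_scale spread_push[OF assms])

lemma simplex_push_normal_spread_iff:
  "simplex_push (obj T m) f (normal_spread m t) = s \<longleftrightarrow>
    simplex_push (obj T m) f (spread T \<pi> m t) = (\<lambda>i. r * s i)"
proof -
  have "inverse r * a = b \<longleftrightarrow> a = r * b" for a b using r_pos by (auto simp: field_simps)
  then show ?thesis by (simp add: normal_spread_def simplex_push_scale fun_eq_iff)
qed

lemma continuous_map_normal_spread:
  "continuous_map (simplex_top m) (simplex_top (obj T m)) (normal_spread m)"
  unfolding continuous_map_in_subtopology continuous_map_componentwise_UNIV
proof (intro conjI allI)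
  fix k
  show "continuous_map (simplex_top m) euclideanreal (\<lambda>t. normal_spread m t k)"
    by (cases "k \<le> obj T m")
      (auto simp: normal_spread_def spread_def
        intro!: continuous_map_real_mult_left continuous_map_component_simplex_top)
qed (use normal_spread_standard_simplex in \<open>auto simp: topspace_standard_simplex\<close>)

lemma normal_spread_exists:
  "\<exists>b. \<forall>s\<in>standard_simplex n. \<exists>m\<le>b. \<exists>f\<in>simplex_hom (obj T m) n. \<exists>t\<in>standard_simplex m.
    simplex_push (obj T m) f (normal_spread m t) = s"
proof -
  obtain b where b: "\<And>s. s \<in> weights (r * 1) n \<Longrightarrow>
    \<exists>m\<le>b. \<exists>f\<in>simplex_hom (obj T m) n. \<exists>t\<in>weights 1 m.
      simplex_push (obj T m) f (spread T \<pi> m t) = s"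
    using spread_exists[of n] zero_less_one by blast
  have "(\<lambda>i. r * s i) \<in> weights (r * 1) n" if "s \<in> weights 1 n" for s
    using weights_scale[OF that] r_pos by simp
  then show ?thesis
    unfolding simplex_push_normal_spread_iff standard_simplex_eq_weights using b by blast
qed

text \<open>Refine \<open>t\<close> and \<open>t'\<close> by a common positive \<open>w\<close>.
  Both composites then push the spread of \<open>w\<close> to the same point, and this spread is
  positive on all of \<open>[T k]\<close> because every vertex there lies over a vertex of
  \<open>[k]\<close>. Hence the composites coincide as monotone maps.\<close>

lemma normal_spread_unique:
  assumes f: "f \<in> simplex_hom (obj T m) n" and g: "g \<in> simplex_hom (obj T m') n"
    and t: "t \<in> standard_simplex m" and t': "t' \<in> standard_simplex m'"
    and eq: "simplex_push (obj T m) f (normal_spread m t) =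
      simplex_push (obj T m') g (normal_spread m' t')"
  obtains k w a b where "a \<in> simplex_hom k m" "b \<in> simplex_hom k m'" "w \<in> standard_simplex k"
    "simplex_push k a w = t" "simplex_push k b w = t'"
    "simplex_comp (obj T k) f (mor T k m a) = simplex_comp (obj T k) g (mor T k m' b)"
proof -
  obtain k w a b where a: "a \<in> simplex_hom k m" and b: "b \<in> simplex_hom k m'"
    and pos: "\<forall>j\<le>k. 0 < w j" "\<forall>j>k. w j = 0"
    and aw: "simplex_push k a w = t" and bw: "simplex_push k b w = t'"
    using common_refinement_exists[of t 1 m t' m'] t t'
    unfolding common_refinement_def standard_simplex_eq_weights by auto
  have w: "w \<in> standard_simplex k"
  proof -
    have "0 \<le> w j" for j using pos by (cases "j \<le> k") (auto simp: less_imp_le)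
    then have "w \<in> weights (\<Sum>j\<le>k. w j) k" using pos by (simp add: weights_def)
    moreover from simplex_push_hom_weights[OF a this] have "(\<Sum>j\<le>k. w j) = 1"
      unfolding aw using t by (simp add: weights_def standard_simplex_eq_weights)
    ultimately show ?thesis by (simp add: standard_simplex_eq_weights)
  qed
  have Ta: "mor T k m a \<in> simplex_hom (obj T k) (obj T m)"
    and Tb: "mor T k m' b \<in> simplex_hom (obj T k) (obj T m')"
    using mor_in_simplex_hom[OF endofunctor] a b by auto
  have "simplex_comp (obj T k) f (mor T k m a) = simplex_comp (obj T k) g (mor T k m' b)"
  proof (rule simplex_push_inj)
    show "0 < normal_spread k w j" if "j \<le> obj T k" for j
      using that pos fold_le[OF that] r_pos by (simp add: normal_spread_def spread_def)
    show "simplex_push (obj T k) (simplex_comp (obj T k) f (mor T k m a)) (normal_spread k w) =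
        simplex_push (obj T k) (simplex_comp (obj T k) g (mor T k m' b)) (normal_spread k w)"
      unfolding simplex_push_simplex_comp[OF Ta] simplex_push_simplex_comp[OF Tb]
        normal_spread_push[OF a, symmetric] normal_spread_push[OF b, symmetric] aw bw by (rule eq)
  qed (rule simplex_comp_in_hom[OF Ta f] simplex_comp_in_hom[OF Tb g])+
  with that a b w aw bw show ?thesis by blast
qed

fun spread_point :: "(nat \<times> 'a) \<times> (nat \<Rightarrow> real) \<Rightarrow> (nat \<times> 'a) \<times> (nat \<Rightarrow> real)" where
  "spread_point ((m, x), t) = ((obj T m, x), normal_spread m t)"

text \<open>The classes in the realization of the pullback that lie over a point of the presentation of
  \<open>X\<close>; there is exactly one, and it depends only on the class of that point.\<close>

fun lifts :: "'a sset \<Rightarrow> (nat \<times> 'a) \<times> (nat \<Rightarrow> real) \<Rightarrow> ((nat \<times> 'a) \<times> (nat \<Rightarrow> real)) set set" where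
  "lifts X ((n, x), s) =
    {glue_class (pullback_sset T X) ((m, act X (obj T m) n f x), t) | m f t.
      f \<in> simplex_hom (obj T m) n \<and> t \<in> standard_simplex m \<and>
      simplex_push (obj T m) f (normal_spread m t) = s}"

text \<open>Gluing in the pullback, written in terms of the vertex maps that index
  \<open>lifts\<close>: moving along \<open>a\<close> replaces \<open>f\<close> by its composite
  with the image of \<open>a\<close> under \<open>T\<close>.\<close>

lemma pullback_glue_class_act:
  assumes X: "simplicial_set X" and x: "x \<in> simplices X n"
    and f: "f \<in> simplex_hom (obj T m) n" and a: "a \<in> simplex_hom k m"
    and w: "w \<in> standard_simplex k"
  shows "glue_class (pullback_sset T X) ((m, act X (obj T m) n f x), simplex_push k a w) =
    glue_class (pullback_sset T X)
      ((k, act X (obj T k) n (simplex_comp (obj T k) f (mor T k m a)) x), w)"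
proof -
  have "act X (obj T m) n f x \<in> simplices (pullback_sset T X) m"
    using simplicial_setD(1)[OF X f x] by (simp add: pullback_sset_def)
  from glue_class_act[OF a this w] show ?thesis
    using simplicial_setD(3)[OF X mor_in_simplex_hom[OF endofunctor a] f x]
    by (simp add: pullback_sset_def)
qed

lemma lifts_unique:
  assumes X: "simplicial_set X" and x: "x \<in> simplices X n"
    and c: "c \<in> lifts X ((n, x), s)" and d: "d \<in> lifts X ((n, x), s)"
  shows "c = d"
proof -
  let ?P = "pullback_sset T X"
  obtain m f t where f: "f \<in> simplex_hom (obj T m) n" and t: "t \<in> standard_simplex m"
    and s: "simplex_push (obj T m) f (normal_spread m t) = s"
    and c: "c = glue_class ?P ((m, act X (obj T m) n f x), t)" using c by auto
  obtain m' g t' where g: "g \<in> simplex_hom (obj T m') n" and t': "t' \<in> standard_simplex m'"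
    and s': "simplex_push (obj T m') g (normal_spread m' t') = s"
    and d: "d = glue_class ?P ((m', act X (obj T m') n g x), t')" using d by auto
  obtain k w a b where "a \<in> simplex_hom k m" "b \<in> simplex_hom k m'" "w \<in> standard_simplex k"
    "simplex_push k a w = t" "simplex_push k b w = t'"
    "simplex_comp (obj T k) f (mor T k m a) = simplex_comp (obj T k) g (mor T k m' b)"
    using normal_spread_unique[OF f g t t'] s s' by metis
  then show ?thesis
    using pullback_glue_class_act[OF X x f, of a k w] pullback_glue_class_act[OF X x g, of b k w]
    by (simp add: c d)
qed

lemma lifts_nonempty:
  assumes "s \<in> standard_simplex n"
  shows "lifts X ((n, x), s) \<noteq> {}"
  using normal_spread_exists[of n] assms by fastforce

text \<open>Composing with the gluing map \<open>g\<close> turns lifts of \<open>p\<close> into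
  lifts of \<open>q\<close> with the same class. A vertex map for \<open>q\<close> need not factor
  through \<open>g\<close>, so the other inclusion is obtained by counting: the smaller set is
  nonempty and the larger has at most one element.\<close>

lemma lifts_glue:
  assumes X: "simplicial_set X" and "glue X p q"
  shows "lifts X p = lifts X q"
  using assms(2)
proof cases
  case (1 g n n' x s)
  have gx: "act X n n' g x \<in> simplices X n" by (rule simplicial_setD(1)[OF X 1(3,4)])
  have sub: "lifts X p \<subseteq> lifts X q"
  proof
    fix c assume "c \<in> lifts X p"
    then obtain m f t where f: "f \<in> simplex_hom (obj T m) n" and t: "t \<in> standard_simplex m"
      and s: "simplex_push (obj T m) f (normal_spread m t) = s"
      and c: "c = glue_class (pullback_sset T X) ((m, act X (obj T m) n f (act X n n' g x)), t)"
      unfolding 1 by auto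
    let ?h = "simplex_comp (obj T m) g f"
    have "?h \<in> simplex_hom (obj T m) n'" by (rule simplex_comp_in_hom[OF f 1(3)])
    moreover have "simplex_push (obj T m) ?h (normal_spread m t) = simplex_push n g s"
      unfolding simplex_push_simplex_comp[OF f] s ..
    moreover have "c = glue_class (pullback_sset T X) ((m, act X (obj T m) n' ?h x), t)"
      unfolding c simplicial_setD(3)[OF X f 1(3,4)] ..
    ultimately show "c \<in> lifts X q" unfolding 1 using t by auto
  qed
  have "lifts X p \<noteq> {}" unfolding 1 by (rule lifts_nonempty[OF 1(5)])
  moreover have "c = d" if "c \<in> lifts X q" "d \<in> lifts X q" for c d
    using that unfolding 1 by (rule lifts_unique[OF X 1(4)])
  ultimately show ?thesis using sub by blast
qed

lemma glue_class_spread_point_eq_iff: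
  fixes X :: "'a sset"
  assumes X: "simplicial_set X"
    and p: "p \<in> topspace (presentation_space (pullback_sset T X))"
    and q: "q \<in> topspace (presentation_space (pullback_sset T X))"
  shows "glue_class X (spread_point p) = glue_class X (spread_point q) \<longleftrightarrow>
    glue_class (pullback_sset T X) p = glue_class (pullback_sset T X) q"
proof
  \<comment> \<open>The identity vertex map presents \<open>p\<close> as a lift of its own image, so
    \<open>lifts\<close> inverts \<open>spread_point\<close> on classes.\<close>
  have mem: "glue_class (pullback_sset T X) p \<in> lifts X (spread_point p)"
    if p: "p \<in> topspace (presentation_space (pullback_sset T X))" for p
  proof -
    obtain m x t where p_eq: "p = ((m, x), t)" and x: "x \<in> simplices X (obj T m)"
      and t: "t \<in> standard_simplex m"
      using p by (auto simp: topspace_presentation_space pullback_sset_def)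
    have "simplex_push (obj T m) (simplex_id (obj T m)) (normal_spread m t) = normal_spread m t"
      using normal_spread_standard_simplex[OF t] unfolding standard_simplex_eq_weights
      by (rule simplex_push_id) (simp add: simplex_id_def)
    then show ?thesis
      using t simplex_id_in_hom[of "obj T m"] simplicial_setD(2)[OF X x]
      unfolding p_eq spread_point.simps lifts.simps
      by (intro CollectI exI[of _ m] exI[of _ "simplex_id (obj T m)"] exI[of _ t]) simp
  qed
  assume "glue_class X (spread_point p) = glue_class X (spread_point q)"
  then have "lifts X (spread_point p) = lifts X (spread_point q)"
    unfolding glue_class_eq_iff
    by (rule equivclp_glue_invariant[where F = "lifts X"]) (rule lifts_glue[OF X])
  then have *: "glue_class (pullback_sset T X) q \<in> lifts X (spread_point p)"
    using mem[OF q] by simp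
  obtain m x t where p_eq: "p = ((m, x), t)" and x: "x \<in> simplices X (obj T m)"
    using p by (auto simp: topspace_presentation_space pullback_sset_def)
  show "glue_class (pullback_sset T X) p = glue_class (pullback_sset T X) q"
    using mem[OF p] * unfolding p_eq spread_point.simps by (rule lifts_unique[OF X x])
next
  have glue: "glue_class X (spread_point p) = glue_class X (spread_point q)"
    if "glue (pullback_sset T X) p q" for p q
    using that
  proof cases
    case (1 f m n x t)
    have "glue_class X ((obj T m, act X (obj T m) (obj T n) (mor T m n f) x), normal_spread m t) =
      glue_class X ((obj T n, x), normal_spread n (simplex_push m f t))"
      unfolding normal_spread_push[OF 1(3)]
      using 1(3-5) by (intro glue_class_act mor_in_simplex_hom[OF endofunctor]
          normal_spread_standard_simplex) (simp_all add: pullback_sset_def)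
    then show ?thesis unfolding 1 by (simp add: pullback_sset_def)
  qed
  assume "glue_class (pullback_sset T X) p = glue_class (pullback_sset T X) q"
  then show "glue_class X (spread_point p) = glue_class X (spread_point q)"
    unfolding glue_class_eq_iff[of "pullback_sset T X"]
    by (rule equivclp_glue_invariant[where F = "\<lambda>p. glue_class X (spread_point p)"]) (rule glue)
qed

text \<open>The criterion by closed sets is used because preimages in a simplex are assembled from
  images of compact sets.\<close>

lemma quotient_map_spread_point:
  assumes X: "simplicial_set X"
  shows "quotient_map (presentation_space (pullback_sset T X)) (realization X)
    (\<lambda>p. glue_class X (spread_point p))"
    (is "quotient_map ?P _ ?q")
proof -
  have cont: "continuous_map ?P (realization X) ?q"
    unfolding presentation_space_def
  proof (rule continuous_map_from_sum_topology)
    fix i assume i: "i \<in> (SIGMA n:UNIV. simplices (pullback_sset T X) n)"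
    obtain m x where i_eq: "i = (m, x)" by (cases i)
    then have x: "x \<in> simplices X (obj T m)" using i by (simp add: pullback_sset_def)
    from continuous_map_compose[OF continuous_map_normal_spread
        continuous_map_simplex_to_realization[OF x]]
    show "continuous_map (case i of (n, x) \<Rightarrow> simplex_top n) (realization X) (\<lambda>t. ?q (i, t))"
      by (simp add: i_eq o_def)
  qed
  have lift: "?q ((m, act X (obj T m) n f x), t) =
      glue_class X ((n, x), simplex_push (obj T m) f (normal_spread m t))"
    if "x \<in> simplices X n" "f \<in> simplex_hom (obj T m) n" "t \<in> standard_simplex m" for m n f x t
    using that by (simp add: glue_class_act normal_spread_standard_simplex)
  have pull: "((m, act X (obj T m) n f x), t) \<in> topspace ?P"
    if "x \<in> simplices X n" "f \<in> simplex_hom (obj T m) n" "t \<in> standard_simplex m" for m n f x t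
    using that simplicial_setD(1)[OF X]
    by (simp add: topspace_presentation_space pullback_sset_def)
  have surj: "?q ` topspace ?P = topspace (realization X)"
  proof
    show "?q ` topspace ?P \<subseteq> topspace (realization X)"
      using continuous_map_image_subset_topspace[OF cont] .
    show "topspace (realization X) \<subseteq> ?q ` topspace ?P"
    proof
      fix c assume "c \<in> topspace (realization X)"
      then obtain n x s where x: "x \<in> simplices X n" and s: "s \<in> standard_simplex n"
        and c: "c = glue_class X ((n, x), s)"
        by (auto simp: topspace_realization topspace_presentation_space)
      obtain m f t where f: "f \<in> simplex_hom (obj T m) n" and t: "t \<in> standard_simplex m"
        and "simplex_push (obj T m) f (normal_spread m t) = s"
        using normal_spread_exists[of n] s by blast
      then have "c = ?q ((m, act X (obj T m) n f x), t)" unfolding c lift[OF x f t] by simp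
      with pull[OF x f t] show "c \<in> ?q ` topspace ?P" by blast
    qed
  qed
  have closed: "closedin (realization X) W"
    if W: "W \<subseteq> topspace (realization X)" and pre: "closedin ?P {p \<in> topspace ?P. ?q p \<in> W}" for W
  proof -
    have "closedin (presentation_space X)
        {p \<in> topspace (presentation_space X). glue_class X p \<in> W}"
      unfolding presentation_space_def closedin_sum_topology
    proof (intro conjI ballI)
      fix i assume i: "i \<in> (SIGMA n:UNIV. simplices X n)"
      obtain n x where i_eq: "i = (n, x)" by (cases i)
      have x: "x \<in> simplices X n" using i i_eq by simp
      obtain b where b: "\<And>s. s \<in> standard_simplex n \<Longrightarrow> \<exists>m\<le>b. \<exists>f\<in>simplex_hom (obj T m) n.
        \<exists>t\<in>standard_simplex m. simplex_push (obj T m) f (normal_spread m t) = s"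
        using normal_spread_exists[of n] by blast
      \<comment> \<open>\<open>A m f\<close> is the preimage of \<open>W\<close> in the simplex of
        the pullback given by \<open>f\<close>, hence compact. The map \<open>\<psi> m f\<close>
        carries it into the simplex of \<open>x\<close>, which is Hausdorff, so the image is
        closed.\<close>
      define A where "A m f = {t \<in> standard_simplex m. ?q ((m, act X (obj T m) n f x), t) \<in> W}"
        for m f
      define \<psi> where "\<psi> m f t = simplex_push (obj T m) f (normal_spread m t)" for m f t
      have closed: "closedin (simplex_top n) (\<psi> m f ` A m f)"
        if f: "f \<in> simplex_hom (obj T m) n" for m f
      proof -
        have fx: "act X (obj T m) n f x \<in> simplices (pullback_sset T X) m"
          using simplicial_setD(1)[OF X f x] by (simp add: pullback_sset_def)
        have "closedin (simplex_top m)
            {t. ((m, act X (obj T m) n f x), t) \<in> {p \<in> topspace ?P. ?q p \<in> W}}"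
          using pre fx unfolding presentation_space_def closedin_sum_topology by auto
        moreover have "{t. ((m, act X (obj T m) n f x), t) \<in> {p \<in> topspace ?P. ?q p \<in> W}} = A m f"
          unfolding A_def using fx by (auto simp: topspace_presentation_space)
        ultimately have "closedin (simplex_top m) (A m f)" by simp
        moreover have "compact_space (simplex_top m)"
          by (simp add: compact_space_subtopology compactin_standard_simplex)
        ultimately have A: "compactin (simplex_top m) (A m f)" by (blast intro: closedin_compact_space)
        have "continuous_map (simplex_top m) (powertop_real UNIV) (\<psi> m f)"
          unfolding \<psi>_def
          using continuous_map_compose[OF continuous_map_normal_spread continuous_map_simplex_push]
          by (simp add: o_def)
        moreover have "\<psi> m f \<in> standard_simplex m \<rightarrow> standard_simplex n"
          unfolding \<psi>_def using simplex_push_standard_simplex[OF f] normal_spread_standard_simplex by auto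
        ultimately have "continuous_map (simplex_top m) (simplex_top n) (\<psi> m f)"
          by (simp add: continuous_map_in_subtopology topspace_standard_simplex)
        from image_compactin[OF A this] show ?thesis
          by (rule compactin_imp_closedin[rotated])
            (intro Hausdorff_space_subtopology, simp add: Hausdorff_space_product_topology)
      qed
      have "closedin (simplex_top n) (\<Union>m\<in>{..b}. \<Union>f\<in>simplex_hom (obj T m) n. \<psi> m f ` A m f)"
        using closed by (intro closedin_Union) (auto intro!: closedin_Union finite_simplex_hom)
      \<comment> \<open>One inclusion is \<open>lift\<close>; the other holds because every
        \<open>s\<close> has a presentation with \<open>m \<le> b\<close>, so finitely many pairs
        \<open>(m, f)\<close> suffice.\<close>
      moreover have "(\<Union>m\<in>{..b}. \<Union>f\<in>simplex_hom (obj T m) n. \<psi> m f ` A m f) =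
          {s \<in> standard_simplex n. glue_class X ((n, x), s) \<in> W}"
      proof (intro equalityI subsetI)
        fix s assume "s \<in> (\<Union>m\<in>{..b}. \<Union>f\<in>simplex_hom (obj T m) n. \<psi> m f ` A m f)"
        then obtain m f t where f: "f \<in> simplex_hom (obj T m) n" and t: "t \<in> A m f"
          and s: "s = \<psi> m f t" by blast
        then show "s \<in> {s \<in> standard_simplex n. glue_class X ((n, x), s) \<in> W}"
          using lift[OF x f, of t] simplex_push_standard_simplex[OF f]
            normal_spread_standard_simplex[of t m]
          unfolding A_def \<psi>_def by simp
      next
        fix s assume s: "s \<in> {s \<in> standard_simplex n. glue_class X ((n, x), s) \<in> W}"
        then obtain m f t where m: "m \<le> b" and f: "f \<in> simplex_hom (obj T m) n"
          and t: "t \<in> standard_simplex m" and eq: "\<psi> m f t = s"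
          unfolding \<psi>_def using b by blast
        then have "t \<in> A m f" using s lift[OF x f t] unfolding A_def \<psi>_def by simp
        then show "s \<in> (\<Union>m\<in>{..b}. \<Union>f\<in>simplex_hom (obj T m) n. \<psi> m f ` A m f)"
          using m f eq by blast
      qed
      moreover have "{t. (i, t) \<in> {p \<in> topspace (presentation_space X). glue_class X p \<in> W}} =
          {s \<in> standard_simplex n. glue_class X ((n, x), s) \<in> W}"
        using x i_eq by (auto simp: topspace_presentation_space)
      ultimately show "closedin (case i of (n, x) \<Rightarrow> simplex_top n)
          {t. (i, t) \<in> {p \<in> topspace (sum_topology (\<lambda>(n, x). simplex_top n)
            (SIGMA n:UNIV. simplices X n)). glue_class X p \<in> W}}"
        by (simp add: i_eq flip: presentation_space_def)
    qed auto
    then show ?thesis using quotient_map_realization[of X] W unfolding quotient_map_closedin by blast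
  qed
  show ?thesis
    unfolding quotient_map_closedin
    using surj closed closedin_continuous_map_preimage[OF cont] by blast
qed

lemma subdivision_homeomorphism:
  assumes "simplicial_set X"
  shows "\<exists>h k. homeomorphic_maps (realization (pullback_sset T X)) (realization X) h k \<and>
    (\<forall>p \<in> topspace (presentation_space (pullback_sset T X)).
      h (glue_class (pullback_sset T X) p) = glue_class X (spread_point p))"
  by (rule homeomorphic_maps_quotients[OF quotient_map_realization quotient_map_spread_point])
    (use assms glue_class_spread_point_eq_iff[OF assms] in auto)

end

section \<open>Weak homotopy equivalences\<close>

lemma sphere_base_in_nsphere: "sphere_base \<in> topspace (nsphere n)"
proof -
  have "(\<Sum>i\<le>n. (sphere_base i)\<^sup>2) = (\<Sum>i\<le>n. if i = 0 then 1 else 0)"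
    by (intro sum.cong) (auto simp: sphere_base_def)
  then show ?thesis by (auto simp: nsphere sphere_base_def)
qed

lemma pointed_homotopy_class_eqI:
  assumes "homotopic_with (\<lambda>h. h sphere_base = x) (nsphere n) X p q"
  shows "pointed_homotopy_class n X x p = pointed_homotopy_class n X x q"
  unfolding pointed_homotopy_class_def
  using assms homotopic_with_trans homotopic_with_symD by blast

text \<open>HOL functions are total, so maps such as \<open>g \<circ> (f \<circ> p)\<close> and
  \<open>p\<close> agree only on the sphere; their classes are nevertheless equal as sets.\<close>

lemma pointed_homotopy_class_cong:
  assumes "continuous_map (nsphere n) X p" "\<And>s. s \<in> topspace (nsphere n) \<Longrightarrow> p s = q s"
    "p sphere_base = x"
  shows "pointed_homotopy_class n X x p = pointed_homotopy_class n X x q"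
  using assms sphere_base_in_nsphere[of n]
  by (intro pointed_homotopy_class_eqI homotopic_with_equal) auto

lemma homotopy_group_setE:
  assumes "c \<in> homotopy_group_set n X x"
  obtains p where "continuous_map (nsphere n) X p" "p sphere_base = x"
    "c = pointed_homotopy_class n X x p"
  using assms by (auto simp: homotopy_group_set_def)

lemma homotopy_group_setI:
  assumes "continuous_map (nsphere n) X p" "p sphere_base = x"
  shows "pointed_homotopy_class n X x p \<in> homotopy_group_set n X x"
  using assms by (auto simp: homotopy_group_set_def)

lemma path_components_ofE:
  assumes "c \<in> path_components_of X"
  obtains x where "x \<in> topspace X" "c = path_component_of_set X x"
  using assms by (auto simp: path_components_of_def)

section \<open>Composition and congruence of weak homotopy equivalences\<close>

lemma path_components_map_compose:
  assumes f: "continuous_map X Y f" and g: "continuous_map Y Z g" and c: "c \<in> path_components_of X"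
  shows "path_components_map Z (g \<circ> f) c = path_components_map Z g (path_components_map Y f c)"
proof -
  obtain x where x: "x \<in> topspace X" and c: "c = path_component_of_set X x"
    using c by (rule path_components_ofE)
  have "f x \<in> topspace Y" using f x by (auto simp: continuous_map_def)
  then show ?thesis
    using path_components_map_class[OF f x] path_components_map_class[OF g]
      path_components_map_class[OF continuous_map_compose[OF f g] x] c by simp
qed

lemma homotopy_group_map_compose:
  assumes f: "continuous_map X Y f" and g: "continuous_map Y Z g"
    and c: "c \<in> homotopy_group_set n X x"
  shows "homotopy_group_map n Z x (g \<circ> f) c =
    homotopy_group_map n Z (f x) g (homotopy_group_map n Y x f c)"
proof -
  obtain p where p: "continuous_map (nsphere n) X p" "p sphere_base = x"
    and c: "c = pointed_homotopy_class n X x p"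
    using c by (rule homotopy_group_setE)
  have "continuous_map (nsphere n) Y (f \<circ> p)" by (rule continuous_map_compose[OF p(1) f])
  then show ?thesis
    using homotopy_group_map_class[OF f p] homotopy_group_map_class[OF g, of n "f \<circ> p" "f x"]
      homotopy_group_map_class[OF continuous_map_compose[OF f g] p] p(2) c
    by (simp add: comp_assoc)
qed

lemma weak_homotopy_equivalence_compose:
  assumes f: "weak_homotopy_equivalence X Y f" and g: "weak_homotopy_equivalence Y Z g"
  shows "weak_homotopy_equivalence X Z (g \<circ> f)"
proof -
  have cf: "continuous_map X Y f" and cg: "continuous_map Y Z g"
    using f g by (simp_all add: weak_homotopy_equivalence_def)
  have "bij_betw (path_components_map Z g \<circ> path_components_map Y f)
      (path_components_of X) (path_components_of Z)"
    using f g by (auto simp: weak_homotopy_equivalence_def intro: bij_betw_trans)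
  then have "bij_betw (path_components_map Z (g \<circ> f)) (path_components_of X) (path_components_of Z)"
    by (rule bij_betw_cong[THEN iffD1, rotated]) (simp add: path_components_map_compose[OF cf cg])
  moreover have "bij_betw (homotopy_group_map n Z x (g \<circ> f))
      (homotopy_group_set n X x) (homotopy_group_set n Z ((g \<circ> f) x))"
    if n: "1 \<le> n" and x: "x \<in> topspace X" for n x
  proof -
    have "f x \<in> topspace Y" using cf x by (auto simp: continuous_map_def)
    then have "bij_betw (homotopy_group_map n Z (f x) g \<circ> homotopy_group_map n Y x f)
        (homotopy_group_set n X x) (homotopy_group_set n Z (g (f x)))"
      using f g n x unfolding weak_homotopy_equivalence_def by (blast intro: bij_betw_trans)
    then have "bij_betw (homotopy_group_map n Z x (g \<circ> f))
        (homotopy_group_set n X x) (homotopy_group_set n Z (g (f x)))"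
      by (rule bij_betw_cong[THEN iffD1, rotated]) (simp add: homotopy_group_map_compose[OF cf cg])
    then show ?thesis by simp
  qed
  ultimately show ?thesis
    using continuous_map_compose[OF cf cg] by (simp add: weak_homotopy_equivalence_def)
qed

text \<open>\<open>realization_map\<close> is defined on arbitrary sets, and the composites compared
  with it agree with it only on points of the realization.\<close>

lemma weak_homotopy_equivalence_cong:
  assumes f: "weak_homotopy_equivalence X Y f" and eq: "\<And>x. x \<in> topspace X \<Longrightarrow> f x = g x"
  shows "weak_homotopy_equivalence X Y g"
proof -
  have cf: "continuous_map X Y f" using f by (simp add: weak_homotopy_equivalence_def)
  then have cg: "continuous_map X Y g" using eq by (rule continuous_map_eq)
  have "path_components_map Y f c = path_components_map Y g c" if "c \<in> path_components_of X" for c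
    using that by (rule path_components_ofE)
      (simp add: path_components_map_class[OF cf] path_components_map_class[OF cg] eq)
  moreover have "bij_betw (path_components_map Y f) (path_components_of X) (path_components_of Y)"
    using f by (simp add: weak_homotopy_equivalence_def)
  ultimately have "bij_betw (path_components_map Y g) (path_components_of X) (path_components_of Y)"
    using bij_betw_cong by metis
  moreover have "bij_betw (homotopy_group_map n Y x g)
      (homotopy_group_set n X x) (homotopy_group_set n Y (g x))"
    if n: "1 \<le> n" and x: "x \<in> topspace X" for n x
  proof -
    have "homotopy_group_map n Y x f c = homotopy_group_map n Y x g c"
      if c: "c \<in> homotopy_group_set n X x" for c
    proof -
      obtain p where p: "continuous_map (nsphere n) X p" "p sphere_base = x"
        and c: "c = pointed_homotopy_class n X x p"
        using c by (rule homotopy_group_setE)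
      have "pointed_homotopy_class n Y (f x) (f \<circ> p) = pointed_homotopy_class n Y (f x) (g \<circ> p)"
        using continuous_map_image_subset_topspace[OF p(1)] eq p(2)
        by (intro pointed_homotopy_class_cong continuous_map_compose[OF p(1) cf]) auto
      then show ?thesis
        unfolding c homotopy_group_map_class[OF cf p] homotopy_group_map_class[OF cg p] eq[OF x] .
    qed
    moreover have "bij_betw (homotopy_group_map n Y x f)
        (homotopy_group_set n X x) (homotopy_group_set n Y (f x))"
      using f n x by (simp add: weak_homotopy_equivalence_def)
    ultimately show ?thesis
      using bij_betw_cong eq[OF x] by metis
  qed
  ultimately show ?thesis using cg by (simp add: weak_homotopy_equivalence_def)
qed

lemma homeomorphic_maps_path_components_inverse:
  assumes "homeomorphic_maps X Y f g" and c: "c \<in> path_components_of X"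
  shows "path_components_map X g (path_components_map Y f c) = c"
    "path_components_map Y f c \<in> path_components_of Y"
proof -
  have f: "continuous_map X Y f" and g: "continuous_map Y X g"
    and gf: "\<And>x. x \<in> topspace X \<Longrightarrow> g (f x) = x"
    using assms by (auto simp: homeomorphic_maps_def)
  obtain x where x: "x \<in> topspace X" and c: "c = path_component_of_set X x"
    using c by (rule path_components_ofE)
  have fx: "f x \<in> topspace Y" using f x by (auto simp: continuous_map_def)
  show "path_components_map X g (path_components_map Y f c) = c"
    unfolding c path_components_map_class[OF f x] path_components_map_class[OF g fx] gf[OF x] ..
  show "path_components_map Y f c \<in> path_components_of Y"
    unfolding c path_components_map_class[OF f x] using fx by (auto simp: path_components_of_def)
qed

lemma homeomorphic_maps_homotopy_group_inverse:
  assumes "homeomorphic_maps X Y f g" and c: "c \<in> homotopy_group_set n X x"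
  shows "homotopy_group_map n X (f x) g (homotopy_group_map n Y x f c) = c"
    "homotopy_group_map n Y x f c \<in> homotopy_group_set n Y (f x)"
proof -
  have f: "continuous_map X Y f" and g: "continuous_map Y X g"
    and gf: "\<And>x. x \<in> topspace X \<Longrightarrow> g (f x) = x"
    using assms by (auto simp: homeomorphic_maps_def)
  obtain p where p: "continuous_map (nsphere n) X p" "p sphere_base = x"
    and c: "c = pointed_homotopy_class n X x p"
    using c by (rule homotopy_group_setE)
  have px: "p s \<in> topspace X" if "s \<in> topspace (nsphere n)" for s
    using p(1) that by (auto simp: continuous_map_def)
  \<comment> \<open>\<open>x\<close> lies in \<open>X\<close> because it is the value of
    \<open>p\<close> at \<open>sphere_base\<close>, a point of the sphere.\<close>
  then have gfx: "g (f x) = x" using gf sphere_base_in_nsphere p(2) by metis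
  have fp: "continuous_map (nsphere n) Y (f \<circ> p)" "(f \<circ> p) sphere_base = f x"
    using continuous_map_compose[OF p(1) f] p(2) by auto
  have "homotopy_group_map n X (f x) g (homotopy_group_map n Y x f c) =
      pointed_homotopy_class n X x (g \<circ> (f \<circ> p))"
    unfolding c homotopy_group_map_class[OF f p] homotopy_group_map_class[OF g fp] gfx ..
  also have "\<dots> = c"
    unfolding c
    by (rule pointed_homotopy_class_cong[OF p(1), symmetric]) (use px gf p(2) in auto)
  finally show "homotopy_group_map n X (f x) g (homotopy_group_map n Y x f c) = c" .
  show "homotopy_group_map n Y x f c \<in> homotopy_group_set n Y (f x)"
    unfolding c homotopy_group_map_class[OF f p] by (rule homotopy_group_setI[OF fp])
qed

lemma weak_homotopy_equivalence_homeomorphic_maps: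
  assumes h: "homeomorphic_maps X Y f g"
  shows "weak_homotopy_equivalence X Y f"
proof -
  have h': "homeomorphic_maps Y X g f" using h homeomorphic_maps_sym by blast
  have f: "continuous_map X Y f" and gf: "\<And>x. x \<in> topspace X \<Longrightarrow> g (f x) = x"
    using h by (auto simp: homeomorphic_maps_def)
  have "bij_betw (path_components_map Y f) (path_components_of X) (path_components_of Y)"
    by (rule bij_betwI[where g = "path_components_map X g"])
      (use homeomorphic_maps_path_components_inverse[OF h]
        homeomorphic_maps_path_components_inverse[OF h'] in auto)
  moreover have "bij_betw (homotopy_group_map n Y x f)
      (homotopy_group_set n X x) (homotopy_group_set n Y (f x))"
    if x: "x \<in> topspace X" for n x
    by (rule bij_betwI[where g = "homotopy_group_map n X (f x) g"])
      (use homeomorphic_maps_homotopy_group_inverse[OF h, of _ n x]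
        homeomorphic_maps_homotopy_group_inverse[OF h', of _ n "f x"] gf[OF x] in auto)
  ultimately show ?thesis using f by (simp add: weak_homotopy_equivalence_def)
qed

text \<open>The subdivision homeomorphisms are natural: \<open>spread_point\<close> changes the
  degree and the coordinates, while a simplicial map changes the simplex alone. So the realized
  pullback map is the realization of \<open>\<phi>\<close> conjugated by homeomorphisms.\<close>

lemma (in folding) pullback_preserves_weak_equivalence:
  assumes X: "simplicial_set X" and Y: "simplicial_set Y" and \<phi>: "sset_weak_equivalence X Y \<phi>"
  shows "sset_weak_equivalence (pullback_sset T X) (pullback_sset T Y) (pullback_sset_map T \<phi>)"
proof -
  let ?X = "pullback_sset T X" and ?Y = "pullback_sset T Y" and ?\<phi> = "pullback_sset_map T \<phi>"
  have map: "sset_map X Y \<phi>"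
    and weq: "weak_homotopy_equivalence (realization X) (realization Y) (realization_map Y \<phi>)"
    using \<phi> by (auto simp: sset_weak_equivalence_def)
  have pmap: "sset_map ?X ?Y ?\<phi>" by (rule sset_map_pullback[OF endofunctor map])
  obtain h k where h: "homeomorphic_maps (realization ?X) (realization X) h k"
    and h_eq: "\<And>p. p \<in> topspace (presentation_space ?X) \<Longrightarrow>
      h (glue_class ?X p) = glue_class X (spread_point p)"
    using subdivision_homeomorphism[OF X] by blast
  obtain h' k' where h': "homeomorphic_maps (realization ?Y) (realization Y) h' k'"
    and h'_eq: "\<And>p. p \<in> topspace (presentation_space ?Y) \<Longrightarrow>
      h' (glue_class ?Y p) = glue_class Y (spread_point p)"
    using subdivision_homeomorphism[OF Y] by blast
  have "weak_homotopy_equivalence (realization ?X) (realization ?Y)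
      (k' \<circ> (realization_map Y \<phi> \<circ> h))"
    using weak_homotopy_equivalence_homeomorphic_maps[OF h] weq
      weak_homotopy_equivalence_homeomorphic_maps[OF homeomorphic_maps_sym[THEN iffD1, OF h']]
    by (intro weak_homotopy_equivalence_compose)
  then have "weak_homotopy_equivalence (realization ?X) (realization ?Y) (realization_map ?Y ?\<phi>)"
  proof (rule weak_homotopy_equivalence_cong)
    fix c assume "c \<in> topspace (realization ?X)"
    then obtain m x t where x: "x \<in> simplices ?X m" and t: "t \<in> standard_simplex m"
      and c: "c = glue_class ?X ((m, x), t)"
      by (auto simp: topspace_realization topspace_presentation_space)
    have \<phi>x: "?\<phi> m x \<in> simplices ?Y m" using pmap x by (auto simp: sset_map_def)
    have p: "((m, x), t) \<in> topspace (presentation_space ?X)"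
      and q: "((m, ?\<phi> m x), t) \<in> topspace (presentation_space ?Y)"
      using x t \<phi>x by (simp_all add: topspace_presentation_space)
    have "realization_map Y \<phi> (h c) = h' (glue_class ?Y ((m, ?\<phi> m x), t))"
      unfolding c h_eq[OF p] h'_eq[OF q] spread_point.simps realization_map_class[OF map]
      by (simp add: pullback_sset_map_def)
    moreover have "glue_class ?Y ((m, ?\<phi> m x), t) \<in> topspace (realization ?Y)"
      using q by (simp add: topspace_realization)
    ultimately show "(k' \<circ> (realization_map Y \<phi> \<circ> h)) c = realization_map ?Y ?\<phi> c"
      using h' unfolding c by (simp add: homeomorphic_maps_def realization_map_class[OF pmap])
  qed
  with pmap show ?thesis by (simp add: sset_weak_equivalence_def)
qed

section \<open>Contractible spaces\<close>

text \<open>The contraction to each point fixes that point throughout. Composing it with a pointed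
  sphere therefore gives a pointed homotopy, and no change of base point is needed.\<close>

definition pointed_contractible :: "'a topology \<Rightarrow> bool" where
  "pointed_contractible X \<longleftrightarrow> topspace X \<noteq> {} \<and>
    (\<forall>x \<in> topspace X. homotopic_with (\<lambda>h. h x = x) X X id (\<lambda>_. x))"

lemma pointed_contractible_path_components:
  assumes "pointed_contractible X"
  shows "path_components_of X = {topspace X}"
proof -
  have "contractible_space X"
    using assms homotopic_with_mono unfolding pointed_contractible_def contractible_space_def
    by (metis (no_types, lifting) ex_in_conv)
  then have "path_connected_space X" by (rule contractible_imp_path_connected_space)
  then show ?thesis
    using assms by (simp add: path_components_of_eq_singleton pointed_contractible_def)
qed

lemma pointed_contractible_homotopy_group_set:
  assumes X: "pointed_contractible X" and x: "x \<in> topspace X"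
  shows "homotopy_group_set n X x = {pointed_homotopy_class n X x (\<lambda>_. x)}"
proof -
  have "pointed_homotopy_class n X x p = pointed_homotopy_class n X x (\<lambda>_. x)"
    if p: "continuous_map (nsphere n) X p" "p sphere_base = x" for p
  proof (rule pointed_homotopy_class_eqI)
    have "homotopic_with (\<lambda>h. h x = x) X X id (\<lambda>_. x)"
      using X x by (simp add: pointed_contractible_def)
    then have "homotopic_with (\<lambda>h. h sphere_base = x) (nsphere n) X (id \<circ> p) ((\<lambda>_. x) \<circ> p)"
      by (rule homotopic_with_compose_continuous_map_right[OF _ p(1)]) (simp add: p(2))
    then show "homotopic_with (\<lambda>h. h sphere_base = x) (nsphere n) X p (\<lambda>_. x)"
      by (simp add: o_def)
  qed
  moreover have "pointed_homotopy_class n X x (\<lambda>_. x) \<in> homotopy_group_set n X x"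
    using x by (intro homotopy_group_setI) auto
  ultimately show ?thesis by (auto simp: homotopy_group_set_def)
qed

lemma weak_homotopy_equivalence_pointed_contractible:
  assumes X: "pointed_contractible X" and Y: "pointed_contractible Y" and f: "continuous_map X Y f"
  shows "weak_homotopy_equivalence X Y f"
proof -
  have fx: "f x \<in> topspace Y" if "x \<in> topspace X" for x
    using f that by (auto simp: continuous_map_def)
  obtain x where x: "x \<in> topspace X" using X unfolding pointed_contractible_def by blast
  have "path_component_of_set X x \<in> path_components_of X"
    "path_component_of_set Y (f x) \<in> path_components_of Y"
    using x fx[OF x] by (auto simp: path_components_of_def)
  then have "path_components_map Y f (topspace X) = topspace Y"
    using path_components_map_class[OF f x] pointed_contractible_path_components[OF X]
      pointed_contractible_path_components[OF Y] by simp
  then have "bij_betw (path_components_map Y f) (path_components_of X) (path_components_of Y)"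
    using pointed_contractible_path_components[OF X] pointed_contractible_path_components[OF Y]
    by (simp add: bij_betw_def)
  moreover have "bij_betw (homotopy_group_map n Y x f)
      (homotopy_group_set n X x) (homotopy_group_set n Y (f x))" if x: "x \<in> topspace X" for n x
    using homotopy_group_map_class[OF f, of n "\<lambda>_. x" x] x
    by (simp add: pointed_contractible_homotopy_group_set[OF X x] bij_betw_def o_def
        pointed_contractible_homotopy_group_set[OF Y fx[OF x]])
  ultimately show ?thesis using f by (simp add: weak_homotopy_equivalence_def)
qed

lemma pointed_contractible_singleton:
  assumes "topspace X = {z}"
  shows "pointed_contractible X"
proof -
  have "homotopic_with (\<lambda>h. h z = z) X X id (\<lambda>_. z)"
    by (rule homotopic_with_equal) (use assms in auto)
  then show ?thesis by (simp add: pointed_contractible_def assms)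
qed

text \<open>The straight-line homotopy towards \<open>x\<close> stays inside the simplex by
  convexity and leaves \<open>x\<close> fixed.\<close>

lemma pointed_contractible_simplex_top: "pointed_contractible (simplex_top k)"
proof -
  have "homotopic_with (\<lambda>h. h x = x) (simplex_top k) (simplex_top k) id (\<lambda>_. x)"
    if x: "x \<in> standard_simplex k" for x
  proof -
    let ?I = "top_of_set {0..1 :: real}" and ?X = "simplex_top k"
    let ?H = "\<lambda>(u :: real, y). \<lambda>i. (1 - u) * y i + u * x i"
    have "continuous_map (prod_topology ?I ?X) (powertop_real UNIV) ?H"
      unfolding continuous_map_componentwise_UNIV
    proof
      fix i
      have u: "continuous_map (prod_topology ?I ?X) euclideanreal fst"
        using continuous_map_fst[of ?I ?X] by (rule continuous_map_into_fulltopology)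
      have y: "continuous_map (prod_topology ?I ?X) euclideanreal (\<lambda>p. snd p i)"
        using continuous_map_compose[OF continuous_map_snd continuous_map_component_simplex_top]
        by (simp add: o_def)
      have "continuous_map (prod_topology ?I ?X) euclideanreal
          (\<lambda>p. (1 - fst p) * snd p i + fst p * x i)"
        by (intro continuous_map_add continuous_map_real_mult continuous_map_diff u y) auto
      then show "continuous_map (prod_topology ?I ?X) euclideanreal (\<lambda>p. ?H p i)"
        by (simp add: case_prod_unfold)
    qed
    moreover have "?H \<in> topspace (prod_topology ?I ?X) \<rightarrow> standard_simplex k"
      using x by (auto intro: convex_standard_simplex)
    ultimately have "continuous_map (prod_topology ?I ?X) ?X ?H"
      by (simp add: continuous_map_in_subtopology)
    moreover have "?H (0, y) = id y" "?H (1, y) = x" for y by auto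
    moreover have "?H (u, x) = x" for u by (auto simp: algebra_simps)
    ultimately show ?thesis
      unfolding homotopic_with_def by (intro exI[of _ ?H]) auto
  qed
  then show ?thesis
    by (simp add: pointed_contractible_def topspace_standard_simplex nonempty_standard_simplex)
qed

section \<open>Standard simplices with encoded elements\<close>

text \<open>The simplicial set represented by \<open>[k]\<close>, with its simplices renamed by
  elements of \<open>'a\<close>. One injection serves all degrees, so a simplex can be decoded
  without knowing its degree.\<close>

locale coded_simplex =
  fixes X :: "'a sset" and code :: "(nat \<Rightarrow> nat) \<Rightarrow> 'a" and k :: nat
  assumes simplices: "\<And>n. simplices X n = code ` simplex_hom n k"
    and act: "\<And>m n f g. f \<in> simplex_hom m n \<Longrightarrow> g \<in> simplex_hom n k \<Longrightarrow>
      act X m n f (code g) = code (simplex_comp m g f)"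
    and code_inj: "inj_on code (\<Union>n. simplex_hom n k)"
begin

lemma simplicial_set: "simplicial_set X"
  unfolding simplicial_set_def
proof (intro conjI allI ballI)
  fix m n f assume "f \<in> simplex_hom m n"
  then show "act X m n f \<in> simplices X n \<rightarrow> simplices X m"
    by (auto simp: simplices act simplex_comp_in_hom)
next
  fix n x assume "x \<in> simplices X n"
  then obtain g where g: "g \<in> simplex_hom n k" "x = code g" by (auto simp: simplices)
  have "simplex_comp n g (simplex_id n) = g"
    using g(1) by (auto simp: simplex_comp_def compose_def simplex_id_def simplex_hom_def
        PiE_iff extensional_def fun_eq_iff)
  then show "act X n n (simplex_id n) x = x" using g simplex_id_in_hom act by metis
next
  fix l m n f g x
  assume f: "f \<in> simplex_hom l m" and g: "g \<in> simplex_hom m n" and "x \<in> simplices X n"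
  then obtain h where h: "h \<in> simplex_hom n k" "x = code h" by (auto simp: simplices)
  have "simplex_comp l h (simplex_comp l g f) = simplex_comp l (simplex_comp m h g) f"
    using simplex_homD(1)[OF f] by (auto simp: simplex_comp_def compose_def fun_eq_iff)
  then show "act X l n (simplex_comp l g f) x = act X l m f (act X m n g x)"
    using f g h by (simp add: act simplex_comp_in_hom)
qed

definition decode :: "'a \<Rightarrow> nat \<Rightarrow> nat" where
  "decode = the_inv_into (\<Union>n. simplex_hom n k) code"

lemma decode_code: "g \<in> simplex_hom n k \<Longrightarrow> decode (code g) = g"
  unfolding decode_def by (rule the_inv_into_f_f[OF code_inj]) auto

lemma decode_in_hom: "x \<in> simplices X n \<Longrightarrow> decode x \<in> simplex_hom n k"
  by (auto simp: simplices decode_code)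

lemma decode_act:
  assumes "f \<in> simplex_hom m n" "x \<in> simplices X n"
  shows "decode (act X m n f x) = simplex_comp m (decode x) f"
  using assms decode_code[OF simplex_comp_in_hom[OF assms(1)]]
  by (auto simp: simplices act decode_code)

text \<open>As in the Yoneda lemma, every simplex \<open>x\<close> arises from the identity of
  \<open>[k]\<close> by acting with \<open>decode x\<close>. Gluing thus moves each point into the
  top cell, to the push-forward of its coordinates along \<open>decode x\<close>; this push-forward
  respects gluing and inverts the inclusion of the cell.\<close>

lemma realization_homeomorphic_simplex:
  obtains f g where "homeomorphic_maps (realization X) (simplex_top k) f g"
proof -
  define e where "e s = glue_class X ((k, code (simplex_id k)), s)" for s
  have id: "code (simplex_id k) \<in> simplices X k" using simplex_id_in_hom by (auto simp: simplices)
  have e: "continuous_map (simplex_top k) (realization X) e"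
    unfolding e_def by (rule continuous_map_simplex_to_realization[OF id])
  have push: "glue_class X ((m, x), t) = e (simplex_push m (decode x) t)"
    if x: "x \<in> simplices X m" and t: "t \<in> standard_simplex m" for m x t
  proof -
    have hom: "decode x \<in> simplex_hom m k" by (rule decode_in_hom[OF x])
    have "simplex_comp m (simplex_id k) (decode x) = decode x"
      using hom by (auto simp: simplex_comp_def compose_def simplex_id_def simplex_hom_def
          PiE_iff extensional_def fun_eq_iff)
    moreover have "code (decode x) = x" using x by (auto simp: simplices decode_code)
    ultimately have "act X m k (decode x) (code (simplex_id k)) = x"
      using act[OF hom simplex_id_in_hom] by simp
    then show ?thesis using glue_class_act[OF hom id t] by (simp add: e_def)
  qed
  define d where "d = (\<lambda>((m, x), t). simplex_push m (decode x) t)"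
  have "continuous_map (presentation_space X) (simplex_top k) d"
    unfolding presentation_space_def
  proof (rule continuous_map_from_sum_topology)
    fix i assume i: "i \<in> (SIGMA n:UNIV. simplices X n)"
    obtain m x where i_eq: "i = (m, x)" by (cases i)
    have "decode x \<in> simplex_hom m k" using i i_eq by (auto intro: decode_in_hom)
    then have "continuous_map (simplex_top m) (simplex_top k) (simplex_push m (decode x))"
      using continuous_map_simplex_push[of m "decode x"]
      by (auto simp: continuous_map_in_subtopology topspace_standard_simplex
          intro: simplex_push_standard_simplex)
    then show "continuous_map (case i of (n, x) \<Rightarrow> simplex_top n) (simplex_top k) (\<lambda>t. d (i, t))"
      by (simp add: i_eq d_def)
  qed
  moreover have "d p = d q" if "glue_class X p = glue_class X q" for p q
    using that unfolding glue_class_eq_iff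
  proof (rule equivclp_glue_invariant)
    fix p q assume "glue X p q"
    then show "d p = d q"
      by cases (simp add: d_def decode_act simplex_push_simplex_comp)
  qed
  ultimately obtain r where r: "continuous_map (realization X) (simplex_top k) r"
    and r_eq: "\<And>p. p \<in> topspace (presentation_space X) \<Longrightarrow> r (glue_class X p) = d p"
    using quotient_map_lift_exists[OF quotient_map_realization] by metis
  have "e (r c) = c" if "c \<in> topspace (realization X)" for c
  proof -
    obtain m x t where "x \<in> simplices X m" "t \<in> standard_simplex m" "c = glue_class X ((m, x), t)"
      using \<open>c \<in> topspace (realization X)\<close>
      by (auto simp: topspace_realization topspace_presentation_space)
    then show ?thesis using push r_eq[of "((m, x), t)"]
      by (simp add: d_def topspace_presentation_space)
  qed
  moreover have "r (e s) = s" if s: "s \<in> standard_simplex k" for s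
  proof -
    have "simplex_push k (simplex_id k) s = s"
      using s unfolding standard_simplex_eq_weights
      by (rule simplex_push_id) (simp add: simplex_id_def)
    then show ?thesis
      using r_eq[of "((k, code (simplex_id k)), s)"] id s
      by (simp add: e_def d_def topspace_presentation_space decode_code[OF simplex_id_in_hom])
  qed
  ultimately have "homeomorphic_maps (realization X) (simplex_top k) r e"
    unfolding homeomorphic_maps_def using r e by (simp add: topspace_standard_simplex)
  then show ?thesis by (rule that)
qed

end

text \<open>There are countably many monotone maps into \<open>[k]\<close> over all degrees
  together, so every infinite type has room for them.\<close>

lemma coded_simplex_exists:
  assumes "infinite (UNIV :: 'a set)"
  obtains X :: "'a sset" and code where "coded_simplex X code k"
proof -
  let ?A = "\<Union>n. simplex_hom n k"
  have "countable ?A" by (auto intro: countable_finite finite_simplex_hom)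
  moreover obtain e :: "nat \<Rightarrow> 'a" where "inj e"
    using infinite_countable_subset[OF assms] by blast
  ultimately have inj: "inj_on (e \<circ> to_nat_on ?A) ?A"
    by (intro comp_inj_on inj_on_to_nat_on) (auto intro: inj_on_subset)
  define code where "code = e \<circ> to_nat_on ?A"
  define X where "X = \<lparr>simplices = (\<lambda>n. code ` simplex_hom n k),
    act = (\<lambda>m n f a. code (simplex_comp m (the_inv_into ?A code a) f))\<rparr>"
  have "the_inv_into ?A code (code g) = g" if "g \<in> simplex_hom n k" for n g
    using inj that by (intro the_inv_into_f_f) (auto simp: code_def)
  then have "coded_simplex X code k"
    by unfold_locales (use inj in \<open>auto simp: X_def code_def\<close>)
  then show ?thesis by (rule that)
qed

section \<open>Pullback along sums containing the constant functor\<close>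

text \<open>Evaluation at a marked vertex maps the pullback of \<open>X\<close> to a discrete simplicial set.\<close>

definition marked_vertex :: "simplex_functor \<Rightarrow> (nat \<Rightarrow> nat) \<Rightarrow> bool" where
  "marked_vertex T v \<longleftrightarrow> (\<forall>m. v m \<le> obj T m) \<and>
    (\<forall>m n. \<forall>f \<in> simplex_hom m n. mor T m n f (v m) = v n)"

lemma marked_vertex_C0: "marked_vertex C0_functor (\<lambda>_. 0)"
  by (auto simp: marked_vertex_def C0_functor_def simplex_id_def)

lemma marked_vertex_add_left: "marked_vertex S v \<Longrightarrow> marked_vertex (functor_add S T) v"
  by (auto simp: marked_vertex_def functor_add_def concat_map_def trans_le_add1 le_SucI)

lemma marked_vertex_add_right:
  "marked_vertex T v \<Longrightarrow> marked_vertex (functor_add S T) (\<lambda>m. obj S m + 1 + v m)"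
  by (auto simp: marked_vertex_def functor_add_def concat_map_def)

lemma marked_vertex_functor_sum:
  "i \<le> n \<Longrightarrow> B i = C0_functor \<Longrightarrow> \<exists>v. marked_vertex (functor_sum B n) v"
proof (induction n)
  case 0
  then show ?case using marked_vertex_C0 by auto
next
  case (Suc n)
  then show ?case
  proof (cases "i = Suc n")
    case True
    then show ?thesis using Suc.prems marked_vertex_add_right[OF marked_vertex_C0] by auto
  next
    case False
    then show ?thesis using Suc marked_vertex_add_left by fastforce
  qed
qed

section \<open>The one-point simplicial set as target of comparison\<close>

definition point_sset :: "'a \<Rightarrow> 'a sset" where
  "point_sset a = \<lparr>simplices = (\<lambda>_. {a}), act = (\<lambda>_ _ _ _. a)\<rparr>"

lemma simplicial_set_point: "simplicial_set (point_sset a)"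
  by (auto simp: simplicial_set_def point_sset_def)

lemma sset_map_to_point: "sset_map X (point_sset a) (\<lambda>_ _. a)"
  by (auto simp: sset_map_def point_sset_def)

lemma pullback_point: "pullback_sset T (point_sset a) = point_sset a"
  by (simp add: pullback_sset_def point_sset_def)

text \<open>The constant maps to \<open>[0]\<close> glue every simplex to the one in degree 0, whose
  geometric simplex is a single point.\<close>

lemma realization_point: "\<exists>z. topspace (realization (point_sset a)) = {z}"
proof -
  let ?P = "point_sset a" and ?t = "\<lambda>j. if j = 0 then 1 else 0 :: real"
  have eq: "glue_class ?P ((m, a), t) = glue_class ?P ((0, a), ?t)" if t: "t \<in> standard_simplex m" for m t
  proof -
    have f: "(\<lambda>_\<in>{..m}. 0) \<in> simplex_hom m 0" by (rule restrict_in_simplex_hom) auto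
    have "simplex_push m (\<lambda>_\<in>{..m}. 0) t = ?t"
      using simplex_push_standard_simplex[OF f t] by (simp add: standard_simplex_0)
    then show ?thesis using glue_class_act[OF f _ t, of a ?P] by (simp add: point_sset_def)
  qed
  have "topspace (realization ?P) \<subseteq> {glue_class ?P ((0, a), ?t)}"
  proof
    fix c assume "c \<in> topspace (realization ?P)"
    then obtain m t where "t \<in> standard_simplex m" "c = glue_class ?P ((m, a), t)"
      unfolding topspace_realization topspace_presentation_space by (auto simp: point_sset_def)
    then show "c \<in> {glue_class ?P ((0, a), ?t)}" using eq by blast
  qed
  moreover have "glue_class ?P ((0, a), ?t) \<in> topspace (realization ?P)"
    by (auto simp: topspace_realization topspace_presentation_space point_sset_def)
  ultimately show ?thesis by blast
qed

lemma (in coded_simplex) weak_equivalence_to_point: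
  "sset_weak_equivalence X (point_sset a) (\<lambda>_ _. a)"
proof -
  let ?P = "point_sset a"
  obtain f g where h: "homeomorphic_maps (realization X) (simplex_top k) f g"
    by (rule realization_homeomorphic_simplex)
  obtain z where z: "topspace (realization ?P) = {z}" by (rule exE[OF realization_point])
  have "weak_homotopy_equivalence (simplex_top k) (realization ?P) (\<lambda>_. z)"
    by (rule weak_homotopy_equivalence_pointed_contractible[OF pointed_contractible_simplex_top
          pointed_contractible_singleton[OF z]]) (simp add: z)
  from weak_homotopy_equivalence_compose[OF weak_homotopy_equivalence_homeomorphic_maps[OF h] this]
  have "weak_homotopy_equivalence (realization X) (realization ?P) (realization_map ?P (\<lambda>_ _. a))"
  proof (rule weak_homotopy_equivalence_cong)
    fix c assume "c \<in> topspace (realization X)"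
    then obtain m x t where t: "t \<in> standard_simplex m" and c: "c = glue_class X ((m, x), t)"
      by (auto simp: topspace_realization topspace_presentation_space)
    have "((m, a), t) \<in> topspace (presentation_space ?P)"
      using t by (simp add: topspace_presentation_space point_sset_def)
    then have "realization_map ?P (\<lambda>_ _. a) c \<in> topspace (realization ?P)"
      unfolding c realization_map_class[OF sset_map_to_point] topspace_realization by (rule imageI)
    then show "((\<lambda>_. z) \<circ> f) c = realization_map ?P (\<lambda>_ _. a) c" by (simp add: z)
  qed
  then show ?thesis using sset_map_to_point by (simp add: sset_weak_equivalence_def)
qed

lemma (in coded_simplex) pullback_not_path_connected:
  assumes T: "is_endofunctor T" and v: "marked_vertex T v" and k: "0 < k"
  shows "\<not> path_connected_space (realization (pullback_sset T X))"
proof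
  let ?X = "pullback_sset T X"
  define d where "d = (\<lambda>((m, x), t :: nat \<Rightarrow> real). decode x (v m))"
  assume "path_connected_space (realization ?X)"
  then have "connected_space (realization ?X)" by (rule path_connected_imp_connected_space)
  have "continuous_map (presentation_space ?X) (discrete_topology UNIV) d"
    unfolding presentation_space_def
    by (rule continuous_map_from_sum_topology) (auto simp: d_def split: prod.split)
  moreover have "d p = d q" if "glue_class ?X p = glue_class ?X q" for p q
    using that unfolding glue_class_eq_iff
  proof (rule equivclp_glue_invariant)
    fix p q assume "glue ?X p q"
    then show "d p = d q"
    proof cases
      case (1 f m n x t)
      have Tf: "mor T m n f \<in> simplex_hom (obj T m) (obj T n)"
        by (rule mor_in_simplex_hom[OF T 1(3)])
      \<comment> \<open>Acting by \<open>mor T m n f\<close> is precomposition with it, and it sends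
        \<open>v m\<close> to \<open>v n\<close>; so gluing preserves the vertex that
        \<open>d\<close> reads off.\<close>
      have "decode (act X (obj T m) (obj T n) (mor T m n f) x) (v m) = decode x (mor T m n f (v m))"
        using v 1(4) decode_act[OF Tf]
        by (simp add: pullback_sset_def simplex_comp_def compose_def marked_vertex_def)
      then show ?thesis using v 1(3) unfolding 1
        by (simp add: d_def pullback_sset_def marked_vertex_def)
    qed
  qed
  ultimately obtain r where r: "continuous_map (realization ?X) (discrete_topology UNIV) r"
    and r_eq: "\<And>p. p \<in> topspace (presentation_space ?X) \<Longrightarrow> r (glue_class ?X p) = d p"
    using quotient_map_lift_exists[OF quotient_map_realization] by metis
  have "connectedin (discrete_topology UNIV) (r ` topspace (realization ?X))"
    using r \<open>connected_space (realization ?X)\<close>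
    by (simp add: connectedin_continuous_map_image flip: connectedin_topspace)
  then obtain y where y: "r ` topspace (realization ?X) \<subseteq> {y}"
    by (auto simp: connectedin_discrete_topology)
  \<comment> \<open>The constant map with value \<open>j\<close> is a simplex of degree 0 in the
    pullback, so \<open>d\<close> takes every value up to \<open>k\<close>, in particular both
    \<open>0\<close> and \<open>1\<close>.\<close>
  have "j = y" if "j \<le> k" for j
  proof -
    let ?g = "\<lambda>_\<in>{..obj T 0}. j" and ?t = "\<lambda>i. if i = 0 then 1 else 0 :: real"
    have g: "?g \<in> simplex_hom (obj T 0) k" using that by (intro restrict_in_simplex_hom) auto
    then have p: "((0, code ?g), ?t) \<in> topspace (presentation_space ?X)"
      by (simp add: topspace_presentation_space pullback_sset_def simplices)
    have "d ((0, code ?g), ?t) = j"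
      using v by (simp add: d_def decode_code[OF g] marked_vertex_def)
    moreover have "r (glue_class ?X ((0, code ?g), ?t)) \<in> {y}"
      using y p unfolding topspace_realization by blast
    ultimately show "j = y" using r_eq[OF p] by simp
  qed
  from this[of 0] this[of 1] k show False by simp
qed

theorem theorem4p6:
  fixes T :: simplex_functor and B :: "nat \<Rightarrow> simplex_functor" and n :: nat
  assumes "infinite (UNIV :: 'a set)"
    and "is_endofunctor T"
    and "\<And>i. i \<le> n \<Longrightarrow> B i \<in> {Id_functor, C0_functor, Op_functor}"
    and "T = functor_sum B n"
  shows "(\<forall>(X :: 'a sset) (Y :: 'a sset) \<phi>.
            simplicial_set X \<and> simplicial_set Y \<and> sset_weak_equivalence X Y \<phi> \<longrightarrow>
            sset_weak_equivalence (pullback_sset T X) (pullback_sset T Y)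
              (pullback_sset_map T \<phi>))
         \<longleftrightarrow> (\<forall>i\<le>n. B i \<noteq> C0_functor)"
proof
  assume "\<forall>i\<le>n. B i \<noteq> C0_functor"
  then have "\<And>i. i \<le> n \<Longrightarrow> B i \<in> {Id_functor, Op_functor}" using assms(3) by blast
  then obtain r \<pi> where "folding T r \<pi>" using folding_functor_sum assms(4) by metis
  then show "\<forall>(X :: 'a sset) (Y :: 'a sset) \<phi>.
      simplicial_set X \<and> simplicial_set Y \<and> sset_weak_equivalence X Y \<phi> \<longrightarrow>
      sset_weak_equivalence (pullback_sset T X) (pullback_sset T Y) (pullback_sset_map T \<phi>)"
    using folding.pullback_preserves_weak_equivalence by blast
next
  assume preserves: "\<forall>(X :: 'a sset) (Y :: 'a sset) \<phi>.
      simplicial_set X \<and> simplicial_set Y \<and> sset_weak_equivalence X Y \<phi> \<longrightarrow>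
      sset_weak_equivalence (pullback_sset T X) (pullback_sset T Y) (pullback_sset_map T \<phi>)"
  show "\<forall>i\<le>n. B i \<noteq> C0_functor"
  proof (intro allI impI notI)
    fix i assume "i \<le> n" "B i = C0_functor"
    then obtain v where v: "marked_vertex T v" using marked_vertex_functor_sum assms(4) by blast
    \<comment> \<open>\<open>[1]\<close> is the smallest choice with two distinct vertices for the
      marked vertex to hit.\<close>
    obtain X :: "'a sset" and code where "coded_simplex X code 1"
      by (rule coded_simplex_exists[OF assms(1)])
    then interpret coded_simplex X code 1 .
    let ?X = "pullback_sset T X" and ?P = "point_sset (undefined :: 'a)"
    have "sset_weak_equivalence ?X ?P (pullback_sset_map T (\<lambda>_ _. undefined))"
      using preserves simplicial_set simplicial_set_point weak_equivalence_to_point pullback_point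
      by metis
    \<comment> \<open>A bijection on path components already yields the contradiction: the point has
      one component, so the pullback would be path connected.\<close>
    then obtain f where
      "bij_betw f (path_components_of (realization ?X)) (path_components_of (realization ?P))"
      by (auto simp: sset_weak_equivalence_def weak_homotopy_equivalence_def)
    moreover obtain z where z: "topspace (realization ?P) = {z}" by (rule exE[OF realization_point])
    ultimately have "card (path_components_of (realization ?X)) = 1"
      using pointed_contractible_path_components[OF pointed_contractible_singleton[OF z]]
        bij_betw_same_card by fastforce
    then obtain c where "path_components_of (realization ?X) = {c}" by (rule card_1_singletonE)
    then have "path_connected_space (realization ?X)"
      by (simp add: path_connected_space_iff_components_eq)
    then show False using pullback_not_path_connected[OF assms(2) v] by simp
  qed
qed

end
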